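(* Let $0<\delta<2$, $0\le\gamma<1$ and $\zeta\ge 0$ satisfy $$0\le\gamma<\frac{\zeta}{1+\zeta}\qquad\text{and}\qquad \frac{\gamma\mu_2}{\mu_1}<\frac{2}{1+\zeta}-\delta+\gamma\le\frac{1+\gamma}{\delta\mu_1(1+\zeta)} .$$ Let $\{x_k\}$ be the sequence of random iterates generated, from $x_0=x_1\in\mathbb{R}^n$, by the momentum method $x_{k+1}=x_k-\delta\,\nabla^Bf_i(x_k)+\gamma(x_k-x_{k-1})$, where at iteration $k$ the index $i=i_k$ is drawn according to $\mathcal{R}$ at $x_k$. Then the sequence of iterates $\{x_k\}$ converges, and there are constants $\alpha\ge 0$ and $0<\rho<1$, depending only on $\delta,\gamma,\zeta,\mu_1,\mu_2$, such that for all $k\ge 1$ $$\mathbb{E}[d_B(x_{k+1},\mathcal{X})^2]\le\rho^k(1+\alpha)\,d_B(x_0,\mathcal{X})^2\quad\text{and}\quad\mathbb{E}[f(x_{k+1})]\le\frac{\mu_2(1+\alpha)}{2}\rho^k\,d_B(x_0,\mathcal{X})^2 .$$ Also, with the same constants, the average iterate $\tilde{x}_k=\frac1k\sum_{l=1}^{k}x_l$ satisfies, for all $k\ge 1$, $$\mathbb{E}[d_B(\tilde{x}_k,\mathcal{X})^2]\le\frac{(1+\alpha)\,d_B(x_0,\mathcal{X})^2}{k(1-\rho)}\quad\text{and}\quad\mathbb{E}[f(\tilde{x}_k)]\le\frac{\mu_2(1+\alpha)}{2k(1-\rho)}\,d_B(x_0,\mathcal{X})^2 .$$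
   Context: $A\in\mathbb{R}^{m\times n}$ has no zero rows, $b\in\mathbb{R}^m$, the system $Ax\le b$ is consistent, and $\mathcal{X}=\{x\in\mathbb{R}^n: Ax\le b\}$. $B\in\mathbb{R}^{n\times n}$ is symmetric positive definite, $\|x\|_B^2=x^TBx$, $\|v\|_{B^{-1}}^2=v^TB^{-1}v$, and $d_B(x,\mathcal{X})=\inf_{y\in\mathcal{X}}\|x-y\|_B$. For a real $t$, $t^+=\max\{t,0\}$. $S_1,\dots,S_q\in\mathbb{R}^m_+$ are fixed sketching vectors (with $A^TS_i\ne 0$), and $$f_i(x)=\frac{|[S_i^T(Ax-b)]^+|^2}{2\|A^TS_i\|_{B^{-1}}^2},\qquad \nabla^B f_i(x)=\frac{[S_i^T(Ax-b)]^+}{\|A^TS_i\|_{B^{-1}}^2}B^{-1}A^TS_i .$$ A sampling rule $\mathcal{R}$ prescribes, given a current point $x$, how a random index $i\in\{1,\dots,q\}$ is chosen; $\mathbb{E}[\,\cdot\mid i\sim\mathcal{R}]$ is the resulting expectation, and $f(x)=\mathbb{E}[f_i(x)\mid i\sim\mathcal{R}]$. The spectral constants $\mu_1>0$ and $\mu_2\le 1$ of the rule are constants such that $\frac{\mu_1}{2}d_B(x,\mathcal{X})^2\le f(x)\le\frac{\mu_2}{2}d_B(x,\mathcal{X})^2$ for all $x\in\mathbb{R}^n$.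
   Formalization: Added assumption: for all y, z, the expectation of f_i(y) with i drawn by the rule at z is at most (μ2/2) d_B(y,X)^2, not only for z = y; without it a point-dependent rule can make the iterates diverge. Convergence of the iterates is almost sure. *)

theory Defs
  imports
    "HOL-Probability.Probability"
    "Jordan_Normal_Form.Gauss_Jordan_Elimination"
begin

(* Dimensions are natural numbers (carrier_vec, carrier_mat) instead of index types, so that a
   statement can bind constants outside the quantifiers over all dimensions. *)

type_synonym rvec = "real Matrix.vec"
type_synonym rmat = "real Matrix.mat"

definition sym_pos_def :: "nat \<Rightarrow> rmat \<Rightarrow> bool" where
  "sym_pos_def n B \<longleftrightarrow>
     B \<in> carrier_mat n n \<and> transpose_mat B = B \<and>
     (\<forall>x \<in> carrier_vec n. x \<noteq> 0\<^sub>v n \<longrightarrow> scalar_prod x (B *\<^sub>v x) > 0)"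

definition sqnorm_wrt :: "rmat \<Rightarrow> rvec \<Rightarrow> real" where
  "sqnorm_wrt B x = scalar_prod x (B *\<^sub>v x)"

definition norm_wrt :: "rmat \<Rightarrow> rvec \<Rightarrow> real" where
  "norm_wrt B x = sqrt (sqnorm_wrt B x)"

(* mat_inverse returns an option; a positive definite matrix is invertible. *)
abbreviation inv_mat :: "rmat \<Rightarrow> rmat" where
  "inv_mat B \<equiv> the (mat_inverse B)"

definition feasible_set :: "rmat \<Rightarrow> rvec \<Rightarrow> rvec set" where
  "feasible_set A b =
     {x \<in> carrier_vec (dim_col A). \<forall>i < dim_row A. vec_index (A *\<^sub>v x) i \<le> vec_index b i}"

definition dist_wrt :: "rmat \<Rightarrow> rvec \<Rightarrow> rvec set \<Rightarrow> real" where
  "dist_wrt B x X = (INF y \<in> X. norm_wrt B (x - y))"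

definition pos_part :: "real \<Rightarrow> real" where
  "pos_part t = max t 0"

definition sketch_loss :: "rmat \<Rightarrow> rmat \<Rightarrow> rvec \<Rightarrow> rvec \<Rightarrow> rvec \<Rightarrow> real" where
  "sketch_loss B A b s x =
     \<bar>pos_part (scalar_prod s (A *\<^sub>v x - b))\<bar>\<^sup>2 /
       (2 * sqnorm_wrt (inv_mat B) (transpose_mat A *\<^sub>v s))"

definition sketch_grad :: "rmat \<Rightarrow> rmat \<Rightarrow> rvec \<Rightarrow> rvec \<Rightarrow> rvec \<Rightarrow> rvec" where
  "sketch_grad B A b s x =
     (pos_part (scalar_prod s (A *\<^sub>v x - b)) / sqnorm_wrt (inv_mat B) (transpose_mat A *\<^sub>v s))
       \<cdot>\<^sub>v (inv_mat B *\<^sub>v (transpose_mat A *\<^sub>v s))"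

(* A sampling rule assigns to each current point the law of the next index. *)
type_synonym rule = "rvec \<Rightarrow> nat pmf"

definition sampling_rule :: "nat \<Rightarrow> nat \<Rightarrow> rule \<Rightarrow> bool" where
  "sampling_rule n q R \<longleftrightarrow> (\<forall>x \<in> carrier_vec n. set_pmf (R x) \<subseteq> {1..q})"

(* The expectation of f_i(y) when the index i is drawn by the rule at the point z. *)
definition loss_drawn_at ::
    "rmat \<Rightarrow> rmat \<Rightarrow> rvec \<Rightarrow> (nat \<Rightarrow> rvec) \<Rightarrow> rule \<Rightarrow> rvec \<Rightarrow> rvec \<Rightarrow> real" where
  "loss_drawn_at B A b S R z y = measure_pmf.expectation (R z) (\<lambda>i. sketch_loss B A b (S i) y)"

definition expected_loss ::
    "rmat \<Rightarrow> rmat \<Rightarrow> rvec \<Rightarrow> (nat \<Rightarrow> rvec) \<Rightarrow> rule \<Rightarrow> rvec \<Rightarrow> real" where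
  "expected_loss B A b S R x = loss_drawn_at B A b S R x x"

definition spectral_constants ::
    "rmat \<Rightarrow> rmat \<Rightarrow> rvec \<Rightarrow> (nat \<Rightarrow> rvec) \<Rightarrow> rule \<Rightarrow> real \<Rightarrow> real \<Rightarrow> bool" where
  "spectral_constants B A b S R \<mu>1 \<mu>2 \<longleftrightarrow>
     (\<forall>x \<in> carrier_vec (dim_col A).
        \<mu>1 / 2 * (dist_wrt B x (feasible_set A b))\<^sup>2 \<le> expected_loss B A b S R x \<and>
        expected_loss B A b S R x \<le> \<mu>2 / 2 * (dist_wrt B x (feasible_set A b))\<^sup>2)"

(* The momentum analysis evaluates f_i at the previous iterate with i drawn at the current one and
   bounds the expectation by the upper spectral bound.  For a rule whose law depends on the point
   this does not follow from spectral_constants, where both points coincide, and without it a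
   point-dependent rule can make the momentum method diverge.  It is automatic if
   - the law does not depend on the point, or
   - the index maximises f_i over a random set of candidates whose law does not depend on the
     point (maximal distance, Kaczmarz-Motzkin sampling), or
   - \<mu>2 = 1, because f_i(y) is at most half the squared distance of y to the feasible set. *)
definition upper_spectral_bound_drawn_anywhere ::
    "rmat \<Rightarrow> rmat \<Rightarrow> rvec \<Rightarrow> (nat \<Rightarrow> rvec) \<Rightarrow> rule \<Rightarrow> real \<Rightarrow> bool" where
  "upper_spectral_bound_drawn_anywhere B A b S R \<mu>2 \<longleftrightarrow>
     (\<forall>z \<in> carrier_vec (dim_col A). \<forall>y \<in> carrier_vec (dim_col A).
        loss_drawn_at B A b S R z y \<le> \<mu>2 / 2 * (dist_wrt B y (feasible_set A b))\<^sup>2)"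

(* Iterates along a sequence \<omega> of indices; \<omega> k is the index used to pass from x_k to x_(k+1),
   for k >= 1, and \<omega> 0 is unused because x_0 = x_1. *)
fun momentum_iter ::
    "rmat \<Rightarrow> rmat \<Rightarrow> rvec \<Rightarrow> (nat \<Rightarrow> rvec) \<Rightarrow> real \<Rightarrow> real \<Rightarrow> rvec \<Rightarrow> (nat \<Rightarrow> nat) \<Rightarrow> nat \<Rightarrow> rvec" where
  "momentum_iter B A b S \<delta> \<gamma> x0 \<omega> 0 = x0"
| "momentum_iter B A b S \<delta> \<gamma> x0 \<omega> (Suc 0) = x0"
| "momentum_iter B A b S \<delta> \<gamma> x0 \<omega> (Suc (Suc k)) =
     momentum_iter B A b S \<delta> \<gamma> x0 \<omega> (Suc k)
     - \<delta> \<cdot>\<^sub>v sketch_grad B A b (S (\<omega> (Suc k))) (momentum_iter B A b S \<delta> \<gamma> x0 \<omega> (Suc k))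
     + \<gamma> \<cdot>\<^sub>v (momentum_iter B A b S \<delta> \<gamma> x0 \<omega> (Suc k) - momentum_iter B A b S \<delta> \<gamma> x0 \<omega> k)"

definition average_iter :: "nat \<Rightarrow> (nat \<Rightarrow> rvec) \<Rightarrow> nat \<Rightarrow> rvec" where
  "average_iter n x k = Matrix.vec n (\<lambda>j. (1 / real k) * (\<Sum>l = 1..k. vec_index (x l) j))"

(* P is the law, on the space of index sequences, of the indices drawn by the method:
   given the indices 1, ..., k-1, the k-th one has law R(x_k). *)
definition index_law ::
    "rmat \<Rightarrow> rmat \<Rightarrow> rvec \<Rightarrow> (nat \<Rightarrow> rvec) \<Rightarrow> rule \<Rightarrow> real \<Rightarrow> real \<Rightarrow> rvec \<Rightarrow> (nat \<Rightarrow> nat) measure \<Rightarrow> bool"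
where
  "index_law B A b S R \<delta> \<gamma> x0 P \<longleftrightarrow>
     prob_space P \<and>
     sets P = sets (Pi\<^sub>M UNIV (\<lambda>_. count_space UNIV)) \<and>
     (\<forall>k \<ge> 1. \<forall>h.
        measure P {\<omega> \<in> space P. \<forall>l \<in> {1..k}. \<omega> l = h l} =
        measure P {\<omega> \<in> space P. \<forall>l \<in> {1..<k}. \<omega> l = h l}
          * pmf (R (momentum_iter B A b S \<delta> \<gamma> x0 h k)) (h k))"

definition converges_vec :: "nat \<Rightarrow> (nat \<Rightarrow> rvec) \<Rightarrow> bool" where
  "converges_vec n x \<longleftrightarrow>
     (\<exists>v \<in> carrier_vec n. \<forall>j < n. (\<lambda>k. vec_index (x k) j) \<longlonglongrightarrow> vec_index v j)"

end

theory Submission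
  imports Defs "Jordan_Normal_Form.Determinant"
begin

text \<open>
  Each loss \<open>f\<^sub>i\<close> is convex, satisfies \<open>\<parallel>\<nabla>f\<^sub>i\<parallel>\<^sub>B\<^sup>2 = 2 f\<^sub>i\<close>, and
  \<open>\<langle>\<nabla>f\<^sub>i(x), x - y\<rangle>\<^sub>B \<ge> 2 f\<^sub>i(x)\<close> for feasible \<open>y\<close>.  Expanding one momentum step with these facts
  bounds both the squared distance of \<open>x\<^sub>k\<^sub>+\<^sub>1\<close> to the feasible set and the squared increment
  \<open>\<parallel>x\<^sub>k\<^sub>+\<^sub>1 - x\<^sub>k\<parallel>\<^sub>B\<^sup>2\<close> in terms of \<open>f\<^sub>i(x\<^sub>k)\<close>, \<open>f\<^sub>i(x\<^sub>k\<^sub>-\<^sub>1)\<close> and the same quantities one step earlier.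
  Adding \<open>\<zeta>\<close> times the second bound to the first and taking expectations gives
  \<open>F\<^sub>k\<^sub>+\<^sub>1 + H\<^sub>k\<^sub>+\<^sub>1 \<le> a F\<^sub>k + b F\<^sub>k\<^sub>-\<^sub>1 + c H\<^sub>k\<close>, where \<open>F\<close> is the expected squared distance, \<open>H\<close> is
  \<open>\<zeta>\<close> times the expected squared increment, \<open>a + b < 1\<close> and \<open>c < 1\<close>; hence geometric decay of both.
  The decay of the increments makes them almost surely summable, so the iterates converge, and
  convexity of the squared distance handles the averages.
\<close>

section \<open>The inner product of a positive definite matrix\<close>

locale pos_def_form =
  fixes n :: nat and B :: rmat
  assumes spd: "sym_pos_def n B"
begin

definition ip :: "rvec \<Rightarrow> rvec \<Rightarrow> real" where
  "ip u v = scalar_prod u (B *\<^sub>v v)"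

abbreviation sqn :: "rvec \<Rightarrow> real" where
  "sqn \<equiv> sqnorm_wrt B"

lemma B_carrier [simp]: "B \<in> carrier_mat n n"
  and B_symmetric: "transpose_mat B = B"
  and B_positive: "x \<in> carrier_vec n \<Longrightarrow> x \<noteq> 0\<^sub>v n \<Longrightarrow> scalar_prod x (B *\<^sub>v x) > 0"
  using spd by (auto simp: sym_pos_def_def)

lemma B_dim [simp]: "dim_row B = n" "dim_col B = n"
  using carrier_matD[OF B_carrier] by auto

lemma B_vec_carrier [simp]: "v \<in> carrier_vec n \<Longrightarrow> B *\<^sub>v v \<in> carrier_vec n"
  using B_carrier by (rule mult_mat_vec_carrier)

lemma sqn_ip: "sqn x = ip x x"
  by (simp add: sqnorm_wrt_def ip_def)

lemma B_zero_vec [simp]: "B *\<^sub>v 0\<^sub>v n = 0\<^sub>v n"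
  by (intro eq_vecI) (auto intro!: scalar_prod_right_zero[of _ n])

lemma ip_commute:
  assumes "u \<in> carrier_vec n" "v \<in> carrier_vec n"
  shows "ip u v = ip v u"
proof -
  have "ip u v = scalar_prod (transpose_mat B *\<^sub>v u) v"
    unfolding ip_def using assms by (subst transpose_vec_mult_scalar[OF B_carrier]) auto
  also have "\<dots> = ip v u"
    unfolding ip_def B_symmetric using assms by (intro comm_scalar_prod[of _ n]) auto
  finally show ?thesis .
qed

lemma ip_add_left:
  "u \<in> carrier_vec n \<Longrightarrow> v \<in> carrier_vec n \<Longrightarrow> w \<in> carrier_vec n \<Longrightarrow> ip (u + v) w = ip u w + ip v w"
  unfolding ip_def by (intro add_scalar_prod_distrib[of _ n]) auto

lemma ip_diff_left:
  "u \<in> carrier_vec n \<Longrightarrow> v \<in> carrier_vec n \<Longrightarrow> w \<in> carrier_vec n \<Longrightarrow> ip (u - v) w = ip u w - ip v w"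
  unfolding ip_def by (intro minus_scalar_prod_distrib[of _ n]) auto

lemma ip_smult_left:
  "u \<in> carrier_vec n \<Longrightarrow> w \<in> carrier_vec n \<Longrightarrow> ip (c \<cdot>\<^sub>v u) w = c * ip u w"
  unfolding ip_def by (intro smult_scalar_prod_distrib[of _ n]) auto

lemma ip_add_right:
  "u \<in> carrier_vec n \<Longrightarrow> v \<in> carrier_vec n \<Longrightarrow> w \<in> carrier_vec n \<Longrightarrow> ip w (u + v) = ip w u + ip w v"
  by (simp add: ip_commute[of w] ip_add_left)

lemma ip_diff_right:
  "u \<in> carrier_vec n \<Longrightarrow> v \<in> carrier_vec n \<Longrightarrow> w \<in> carrier_vec n \<Longrightarrow> ip w (u - v) = ip w u - ip w v"
  by (simp add: ip_commute[of w] ip_diff_left)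

lemma ip_smult_right:
  "u \<in> carrier_vec n \<Longrightarrow> w \<in> carrier_vec n \<Longrightarrow> ip w (c \<cdot>\<^sub>v u) = c * ip w u"
  by (simp add: ip_commute[of w] ip_smult_left)

lemmas ip_linear = ip_add_left ip_diff_left ip_smult_left ip_add_right ip_diff_right ip_smult_right

lemma sqn_nonneg: "x \<in> carrier_vec n \<Longrightarrow> 0 \<le> sqn x"
  using B_positive[of x] by (cases "x = 0\<^sub>v n") (auto simp: sqnorm_wrt_def)

lemma sqn_convex_combination:
  assumes "v \<in> carrier_vec n" "w \<in> carrier_vec n"
  shows "sqn ((1 - u) \<cdot>\<^sub>v v + u \<cdot>\<^sub>v w) = (1 - u) * sqn v + u * sqn w - u * (1 - u) * sqn (v - w)"
  using assms by (simp add: sqn_ip ip_linear ip_commute[of w v] algebra_simps)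

text \<open>A kernel vector would contradict positivity, so the determinant is nonzero and
  \<open>mat_inverse B\<close> is not \<open>None\<close>; only then does \<open>inv_mat B\<close>
  denote an actual inverse.\<close>

lemma inv_B_carrier: "inv_mat B \<in> carrier_mat n n"
  and B_inv_B: "B * inv_mat B = 1\<^sub>m n"
proof -
  have "Determinant.det B \<noteq> 0"
  proof
    assume "Determinant.det B = 0"
    then obtain v where v: "v \<in> carrier_vec n" "v \<noteq> 0\<^sub>v n" "B *\<^sub>v v = 0\<^sub>v n"
      using det_0_iff_vec_prod_zero_field[OF B_carrier] by auto
    with B_positive[of v] show False by simp
  qed
  then have "B \<in> Units (ring_mat TYPE(real) n ())"
    by (rule det_non_zero_imp_unit[OF B_carrier])
  then obtain C where "mat_inverse B = Some C"
    using mat_inverse(1)[OF B_carrier, of "()"] by fastforce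
  with mat_inverse(2)[OF B_carrier this]
  show "inv_mat B \<in> carrier_mat n n" "B * inv_mat B = 1\<^sub>m n" by auto
qed

lemma B_inv_B_vec: "v \<in> carrier_vec n \<Longrightarrow> B *\<^sub>v (inv_mat B *\<^sub>v v) = v"
  by (metis B_carrier B_inv_B assoc_mult_mat_vec inv_B_carrier one_mult_mat_vec)

lemma inv_B_vec_carrier [simp]: "v \<in> carrier_vec n \<Longrightarrow> inv_mat B *\<^sub>v v \<in> carrier_vec n"
  using inv_B_carrier by (rule mult_mat_vec_carrier)

text \<open>\<open>inv_mat B\<close> is the Riesz map: it turns a Euclidean functional into the
  vector representing it in \<open>ip\<close>. The gradients are multiples of such vectors.\<close>

lemma ip_inv_B_right:
  "v \<in> carrier_vec n \<Longrightarrow> ip w (inv_mat B *\<^sub>v v) = scalar_prod w v"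
  by (simp add: ip_def B_inv_B_vec)

lemma ip_inv_B_left:
  "v \<in> carrier_vec n \<Longrightarrow> w \<in> carrier_vec n \<Longrightarrow> ip (inv_mat B *\<^sub>v v) w = scalar_prod v w"
  by (simp add: ip_commute[of _ w] ip_inv_B_right comm_scalar_prod[of w n v])

lemma sqn_inv_B:
  assumes "v \<in> carrier_vec n"
  shows "sqn (inv_mat B *\<^sub>v v) = sqnorm_wrt (inv_mat B) v"
  using assms by (simp add: sqn_ip ip_inv_B_left) (simp add: sqnorm_wrt_def)

lemma sqnorm_inv_B_pos:
  assumes "v \<in> carrier_vec n" "v \<noteq> 0\<^sub>v n"
  shows "sqnorm_wrt (inv_mat B) v > 0"
proof -
  have "inv_mat B *\<^sub>v v \<noteq> 0\<^sub>v n"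
  proof
    assume "inv_mat B *\<^sub>v v = 0\<^sub>v n"
    then show False using B_inv_B_vec[OF assms(1)] assms(2) by (metis B_zero_vec)
  qed
  then show ?thesis
    using B_positive[of "inv_mat B *\<^sub>v v"] sqn_inv_B[OF assms(1)] assms(1)
    by (simp add: sqnorm_wrt_def)
qed

lemma Cauchy_Schwarz:
  assumes "u \<in> carrier_vec n" "v \<in> carrier_vec n"
  shows "(ip u v)\<^sup>2 \<le> sqn u * sqn v"
proof (cases "v = 0\<^sub>v n")
  case True
  then show ?thesis using assms True by (simp add: ip_def sqnorm_wrt_def)
next
  case False
  then have pos: "sqn v > 0" using B_positive[OF assms(2)] by (simp add: sqnorm_wrt_def)
  \<comment> \<open>The coefficient of the orthogonal projection of \<open>u\<close> onto the line
    through \<open>v\<close>.\<close>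
  define c where "c = ip u v / sqn v"
  have "0 \<le> sqn (u - c \<cdot>\<^sub>v v)" using assms by (intro sqn_nonneg) auto
  also have "sqn (u - c \<cdot>\<^sub>v v) = sqn u - 2 * c * ip u v + c\<^sup>2 * sqn v"
    using assms by (simp add: sqn_ip ip_linear ip_commute[of v u] algebra_simps power2_eq_square)
  also have "\<dots> = sqn u - (ip u v)\<^sup>2 / sqn v"
    using pos by (simp add: c_def field_simps power2_eq_square)
  finally show ?thesis using pos by (simp add: field_simps)
qed

text \<open>A coordinate is the pairing with the Riesz representative of a unit vector, so
  Cauchy-Schwarz applies. It transfers bounds on \<open>sqn\<close> to coordinatewise
  convergence.\<close>

lemma coordinate_bound:
  assumes "j < n"
  obtains C where "C \<ge> 0" "\<And>v. v \<in> carrier_vec n \<Longrightarrow> (vec_index v j)\<^sup>2 \<le> C * sqn v"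
proof
  let ?e = "unit_vec n j :: rvec"
  show "0 \<le> sqn (inv_mat B *\<^sub>v ?e)" by (rule sqn_nonneg) simp
  show "(vec_index v j)\<^sup>2 \<le> sqn (inv_mat B *\<^sub>v ?e) * sqn v" if v: "v \<in> carrier_vec n" for v
    using Cauchy_Schwarz[of "inv_mat B *\<^sub>v ?e" v] v assms by (simp add: ip_inv_B_left)
qed

section \<open>Squared distance to a set\<close>

lemma dist_wrt_nonneg:
  assumes "X \<noteq> {}" "X \<subseteq> carrier_vec n" "x \<in> carrier_vec n"
  shows "0 \<le> dist_wrt B x X"
  unfolding dist_wrt_def norm_wrt_def using assms by (intro cINF_greatest) (auto intro!: sqn_nonneg)

lemma dist_wrt_sq_le:
  assumes "X \<subseteq> carrier_vec n" "x \<in> carrier_vec n" "y \<in> X"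
  shows "(dist_wrt B x X)\<^sup>2 \<le> sqn (x - y)"
proof -
  have nn: "0 \<le> sqn (x - z)" if "z \<in> X" for z using that assms by (intro sqn_nonneg) auto
  have "dist_wrt B x X \<le> norm_wrt B (x - y)"
    unfolding dist_wrt_def using nn assms(3)
    by (intro cINF_lower bdd_belowI2[of _ 0]) (auto simp: norm_wrt_def)
  then have "(dist_wrt B x X)\<^sup>2 \<le> (norm_wrt B (x - y))\<^sup>2"
    using dist_wrt_nonneg[of X x] assms by (intro power_mono) auto
  then show ?thesis using nn[OF assms(3)] by (simp add: norm_wrt_def)
qed

text \<open>Near-minimisers replace the projection onto \<open>X\<close>, so attainment of the
  infimum is never established; estimates using them remove \<open>e\<close> by
  \<open>field_le_epsilon\<close>.\<close>

lemma dist_wrt_sq_approx: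
  assumes "X \<noteq> {}" "X \<subseteq> carrier_vec n" "x \<in> carrier_vec n" "0 < e"
  obtains y where "y \<in> X" "sqn (x - y) < (dist_wrt B x X)\<^sup>2 + e"
proof -
  have d: "0 \<le> dist_wrt B x X" using assms by (intro dist_wrt_nonneg)
  have "dist_wrt B x X < sqrt ((dist_wrt B x X)\<^sup>2 + e)"
    using assms(4) d by (intro real_less_rsqrt) auto
  moreover have "bdd_below ((\<lambda>y. norm_wrt B (x - y)) ` X)"
    using assms by (intro bdd_belowI2[of _ 0]) (auto simp: norm_wrt_def intro!: sqn_nonneg)
  ultimately obtain y where "y \<in> X" "norm_wrt B (x - y) < sqrt ((dist_wrt B x X)\<^sup>2 + e)"
    unfolding dist_wrt_def using assms(1) by (subst (asm) cINF_less_iff) auto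
  then show thesis using that by (auto simp: norm_wrt_def)
qed

text \<open>The combination of near-minimisers for \<open>x\<close> and \<open>y\<close> lies in
  \<open>X\<close> and competes in the infimum for the combined point.\<close>

lemma dist_wrt_sq_convex:
  assumes X: "X \<noteq> {}" "X \<subseteq> carrier_vec n"
    and conv: "\<And>p r. p \<in> X \<Longrightarrow> r \<in> X \<Longrightarrow> (1 - u) \<cdot>\<^sub>v p + u \<cdot>\<^sub>v r \<in> X"
    and x: "x \<in> carrier_vec n" and y: "y \<in> carrier_vec n" and u: "0 \<le> u" "u \<le> 1"
  shows "(dist_wrt B ((1 - u) \<cdot>\<^sub>v x + u \<cdot>\<^sub>v y) X)\<^sup>2 \<le>
    (1 - u) * (dist_wrt B x X)\<^sup>2 + u * (dist_wrt B y X)\<^sup>2"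
proof (rule field_le_epsilon)
  fix e :: real assume e: "0 < e"
  obtain p where p: "p \<in> X" "sqn (x - p) < (dist_wrt B x X)\<^sup>2 + e"
    using dist_wrt_sq_approx[OF X x e] .
  obtain r where r: "r \<in> X" "sqn (y - r) < (dist_wrt B y X)\<^sup>2 + e"
    using dist_wrt_sq_approx[OF X y e] .
  have pr [simp]: "p \<in> carrier_vec n" "r \<in> carrier_vec n" using p r X by auto
  have dims [simp]: "dim_vec p = n" "dim_vec r = n" "dim_vec x = n" "dim_vec y = n"
    using pr x y by auto
  let ?z = "(1 - u) \<cdot>\<^sub>v x + u \<cdot>\<^sub>v y"
  have eq: "?z - ((1 - u) \<cdot>\<^sub>v p + u \<cdot>\<^sub>v r) = (1 - u) \<cdot>\<^sub>v (x - p) + u \<cdot>\<^sub>v (y - r)"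
    by (intro eq_vecI) (auto simp: algebra_simps)
  have "(dist_wrt B ?z X)\<^sup>2 \<le> sqn (?z - ((1 - u) \<cdot>\<^sub>v p + u \<cdot>\<^sub>v r))"
    using X x y p r by (intro dist_wrt_sq_le conv) auto
  also have "\<dots> = (1 - u) * sqn (x - p) + u * sqn (y - r) - u * (1 - u) * sqn ((x - p) - (y - r))"
    unfolding eq using x y by (intro sqn_convex_combination) auto
  also have "\<dots> \<le> (1 - u) * sqn (x - p) + u * sqn (y - r)"
    using x y u sqn_nonneg[of "(x - p) - (y - r)"] by simp
  also have "\<dots> \<le> (1 - u) * ((dist_wrt B x X)\<^sup>2 + e) + u * ((dist_wrt B y X)\<^sup>2 + e)"
    using p r u by (intro add_mono mult_left_mono) auto
  also have "\<dots> = (1 - u) * (dist_wrt B x X)\<^sup>2 + u * (dist_wrt B y X)\<^sup>2 + e"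
    by (simp add: algebra_simps)
  finally show "(dist_wrt B ?z X)\<^sup>2 \<le> (1 - u) * (dist_wrt B x X)\<^sup>2 + u * (dist_wrt B y X)\<^sup>2 + e" .
qed

end

section \<open>A two-step recursion\<close>

text \<open>The sequences are quantified inside, which ties \<open>\<alpha>\<close> and
  \<open>\<rho>\<close> to the coefficients alone: the theorem chooses its constants before the
  dimensions, the system and the sampling rule. The initial conditions reflect that the first two
  iterates coincide.\<close>

definition two_step_rate :: "real \<Rightarrow> real \<Rightarrow> real \<Rightarrow> real \<Rightarrow> real \<Rightarrow> bool" where
  "two_step_rate a b c \<alpha> \<rho> \<longleftrightarrow>
    (\<forall>F H :: nat \<Rightarrow> real. (\<forall>k. 0 \<le> F k) \<longrightarrow> (\<forall>k. 0 \<le> H k) \<longrightarrow> F 1 = F 0 \<longrightarrow> H 1 = 0 \<longrightarrow>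
      (\<forall>k. F (k + 2) + H (k + 2) \<le> a * F (k + 1) + b * F k + c * H (k + 1)) \<longrightarrow>
      (\<forall>k. F (k + 1) + H (k + 1) \<le> \<rho> ^ k * (1 + \<alpha>) * F 0))"

lemma two_step_rateD:
  fixes F H :: "nat \<Rightarrow> real"
  assumes "two_step_rate a b c \<alpha> \<rho>" "\<And>k. 0 \<le> F k" "\<And>k. 0 \<le> H k" "F 1 = F 0" "H 1 = 0"
    "\<And>k. F (k + 2) + H (k + 2) \<le> a * F (k + 1) + b * F k + c * H (k + 1)"
  shows "F (k + 1) + H (k + 1) \<le> \<rho> ^ k * (1 + \<alpha>) * F 0"
  using assms unfolding two_step_rate_def by blast

lemma two_step_recursion:
  fixes a b c :: real
  assumes a: "a < 2" and ab: "a + b < 1" and c: "c < 1"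
  obtains \<alpha> \<rho> :: real where "0 \<le> \<alpha>" "0 < \<rho>" "\<rho> < 1" "two_step_rate a b c \<alpha> \<rho>"
proof -
  (* F (k + 1) - t * F k + H (k + 1) with t = a - R contracts by the factor R as soon as
     R * t + b <= 0, whatever the sign of b; a + b < 1 makes this possible for R near 1. *)
  have "\<forall>\<^sub>F R in at_left 1. 0 < R \<and> c < R \<and> a - R < R \<and> R * (a - R) + b < 0 \<and> R < (1 :: real)"
  proof (intro eventually_conj)
    show "\<forall>\<^sub>F R in at_left 1. (0 :: real) < R"
      by (intro order_tendstoD[of _ 1]) auto
    show "\<forall>\<^sub>F R in at_left 1. c < R"
      using c by (intro order_tendstoD[of _ 1]) auto
    have "((\<lambda>R. a - R - R) \<longlongrightarrow> a - 1 - 1) (at_left 1)" by (intro tendsto_intros)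
    then have "\<forall>\<^sub>F R in at_left 1. a - R - R < 0"
      using a by (intro order_tendstoD) auto
    then show "\<forall>\<^sub>F R in at_left 1. a - R < R" by eventually_elim auto
    have "((\<lambda>R. R * (a - R) + b) \<longlongrightarrow> 1 * (a - 1) + b) (at_left 1)" by (intro tendsto_intros)
    then show "\<forall>\<^sub>F R in at_left 1. R * (a - R) + b < 0"
      using ab by (intro order_tendstoD) auto
    show "\<forall>\<^sub>F R in at_left 1. R < (1 :: real)"
      by (simp add: eventually_at_filter)
  qed
  then obtain R where R: "0 < R" "c < R" "a - R < R" "R * (a - R) + b < 0" "R < 1"
    using eventually_happens' trivial_limit_at_left_real by (metis (no_types, lifting))
  define t where "t = a - R"
  have t: "t < R" "t < 1" "R * t + b < 0" using R by (auto simp: t_def)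
  \<comment> \<open>\<open>M\<close> is the solution of the equation \<open>step\<close>, which is
    exactly what carries the bound \<open>R ^ k * (M * F 0)\<close> through the second induction;
    \<open>t < R\<close> keeps the denominator positive.\<close>
  define M where "M = (if t \<le> 0 then 1 - t else R * (1 - t) / (R - t))"
  have M1: "1 \<le> M"
  proof (cases "t \<le> 0")
    case False
    have "t * R \<le> t * 1" using False R by (intro mult_left_mono) auto
    then show ?thesis using False t by (simp add: M_def field_simps)
  qed (auto simp: M_def)
  have step: "max t 0 * M + R * (1 - t) = R * M"
    using R t by (auto simp: M_def max_def field_simps)
  show thesis
  proof (rule that[of "M - 1" R])
    show "0 \<le> M - 1" "0 < R" "R < 1" using M1 R by auto
    show "two_step_rate a b c (M - 1) R"
      unfolding two_step_rate_def
    proof (intro allI impI)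
      fix F H :: "nat \<Rightarrow> real" and k
      assume F: "\<forall>k. 0 \<le> F k" and H: "\<forall>k. 0 \<le> H k" and F1: "F 1 = F 0" and H1: "H 1 = 0"
        and rec: "\<forall>k. F (k + 2) + H (k + 2) \<le> a * F (k + 1) + b * F k + c * H (k + 1)"
      have G: "F (k + 1) - t * F k + H (k + 1) \<le> R ^ k * ((1 - t) * F 0)" for k
      proof (induction k)
        case 0
        show ?case using F1 H1 by (simp add: algebra_simps)
      next
        case (Suc k)
        have "F (k + 2) - t * F (k + 1) + H (k + 2) \<le> R * F (k + 1) + b * F k + c * H (k + 1)"
          using spec[OF rec, of k] by (simp add: t_def algebra_simps)
        also have "\<dots> \<le> R * F (k + 1) + (- R * t) * F k + R * H (k + 1)"
          using t R spec[OF F, of k] spec[OF F, of "Suc k"] spec[OF H, of "k + 1"] by (intro add_mono mult_right_mono) auto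
        also have "\<dots> = R * (F (k + 1) - t * F k + H (k + 1))" by (simp add: algebra_simps)
        also have "\<dots> \<le> R * (R ^ k * ((1 - t) * F 0))"
          using Suc R by (intro mult_left_mono) auto
        finally show ?case by (simp add: mult_ac)
      qed
      have "F (k + 1) + H (k + 1) \<le> R ^ k * (M * F 0)" for k
      proof (induction k)
        case 0
        show ?case using F1 H1 M1 spec[OF F, of 0] mult_right_mono[of 1 M "F 0"] by simp
      next
        case (Suc k)
        have "F (k + 2) + H (k + 2) \<le> t * F (k + 1) + R ^ (k + 1) * ((1 - t) * F 0)"
          using G[of "k + 1"] by (simp add: algebra_simps)
        \<comment> \<open>A nonnegative factor allows the term in \<open>H\<close> to be added,
          after which the induction hypothesis applies.\<close>
        also have "\<dots> \<le> max t 0 * (F (k + 1) + H (k + 1)) + R ^ (k + 1) * ((1 - t) * F 0)"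
        proof -
          have "t * F (k + 1) \<le> max t 0 * F (k + 1)" using spec[OF F, of "k + 1"] by (intro mult_right_mono) auto
          moreover have "0 \<le> max t 0 * H (k + 1)" using spec[OF H, of "k + 1"] by simp
          ultimately show ?thesis by (simp add: distrib_left)
        qed
        also have "\<dots> \<le> max t 0 * (R ^ k * (M * F 0)) + R ^ (k + 1) * ((1 - t) * F 0)"
          using Suc by (intro add_right_mono mult_left_mono) auto
        also have "\<dots> = R ^ k * F 0 * (max t 0 * M + R * (1 - t))" by (simp add: algebra_simps)
        also have "\<dots> = R ^ (k + 1) * (M * F 0)" unfolding step by simp
        finally show ?case by simp
      qed
      then show "F (k + 1) + H (k + 1) \<le> R ^ k * (1 + (M - 1)) * F 0" by (simp add: mult_ac)
    qed
  qed
qed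

section \<open>One step of the momentum method\<close>

locale sketched_system = pos_def_form n B for n B +
  fixes m q :: nat and A :: rmat and b :: rvec and S :: "nat \<Rightarrow> rvec" and R :: rule
  assumes A_carrier: "A \<in> carrier_mat m n" and b_carrier: "b \<in> carrier_vec m"
    and feasible: "feasible_set A b \<noteq> {}"
    and sketch_carrier: "i \<in> {1..q} \<Longrightarrow> S i \<in> carrier_vec m"
    and sketch_nonneg: "i \<in> {1..q} \<Longrightarrow> j < m \<Longrightarrow> 0 \<le> vec_index (S i) j"
    and sketch_normal: "i \<in> {1..q} \<Longrightarrow> transpose_mat A *\<^sub>v S i \<noteq> 0\<^sub>v n"
    and rule: "sampling_rule n q R"
begin

abbreviation X :: "rvec set" where "X \<equiv> feasible_set A b"
abbreviation loss :: "nat \<Rightarrow> rvec \<Rightarrow> real" where "loss i \<equiv> sketch_loss B A b (S i)"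
abbreviation grad :: "nat \<Rightarrow> rvec \<Rightarrow> rvec" where "grad i \<equiv> sketch_grad B A b (S i)"
abbreviation dsq :: "rvec \<Rightarrow> real" where "dsq x \<equiv> (dist_wrt B x X)\<^sup>2"

text \<open>Sketch \<open>i\<close> yields the half-space \<open>res i x \<le> 0\<close> with
  Euclidean normal \<open>normal i\<close>, whose squared dual norm is \<open>weight i\<close>. The
  loss is half the squared distance to this half-space in the norm of \<open>B\<close>, and the
  gradient is \<open>x\<close> minus its projection onto it.\<close>

definition normal :: "nat \<Rightarrow> rvec" where "normal i = transpose_mat A *\<^sub>v S i"
definition weight :: "nat \<Rightarrow> real" where "weight i = sqnorm_wrt (inv_mat B) (normal i)"
definition res :: "nat \<Rightarrow> rvec \<Rightarrow> real" where "res i x = scalar_prod (S i) (A *\<^sub>v x - b)"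

lemma A_dim [simp]: "dim_row A = m" "dim_col A = n"
  using A_carrier by auto

lemma b_dim [simp]: "dim_vec b = m"
  using b_carrier by auto

lemma X_carrier: "X \<subseteq> carrier_vec n"
  by (auto simp: feasible_set_def)

lemma normal_carrier [simp]: "normal i \<in> carrier_vec n"
  by (auto simp: normal_def intro!: carrier_vecI)

lemma weight_pos: "i \<in> {1..q} \<Longrightarrow> weight i > 0"
  unfolding weight_def using sketch_normal[of i]
  by (intro sqnorm_inv_B_pos normal_carrier) (simp add: normal_def)

lemma loss_eq: "loss i x = (pos_part (res i x))\<^sup>2 / (2 * weight i)"
  by (simp add: sketch_loss_def res_def weight_def normal_def)

lemma grad_eq: "grad i x = (pos_part (res i x) / weight i) \<cdot>\<^sub>v (inv_mat B *\<^sub>v normal i)"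
  by (simp add: sketch_grad_def res_def weight_def normal_def)

lemma grad_carrier [simp]: "grad i x \<in> carrier_vec n"
  by (simp add: grad_eq)

lemma grad_dim [simp]: "dim_vec (grad i x) = n"
  using grad_carrier by (rule carrier_vecD)

lemma loss_nonneg: "i \<in> {1..q} \<Longrightarrow> 0 \<le> loss i x"
  using weight_pos[of i] by (simp add: loss_eq)

lemma res_diff:
  assumes "i \<in> {1..q}" "x \<in> carrier_vec n" "y \<in> carrier_vec n"
  shows "scalar_prod (normal i) (x - y) = res i x - res i y"
proof -
  have "scalar_prod (normal i) (x - y) = scalar_prod (S i) (A *\<^sub>v (x - y))"
    unfolding normal_def using assms sketch_carrier A_carrier
    by (intro transpose_vec_mult_scalar[of A m n]) auto
  also have "A *\<^sub>v (x - y) = (A *\<^sub>v x - b) - (A *\<^sub>v y - b)"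
    using mult_minus_distrib_mat_vec[OF A_carrier assms(2,3)] by auto
  also have "scalar_prod (S i) \<dots> = res i x - res i y"
    unfolding res_def using assms sketch_carrier A_carrier b_carrier
    by (intro scalar_prod_minus_distrib[of _ m]) (auto intro!: carrier_vecI)
  finally show ?thesis .
qed

text \<open>Combining the inequalities of the system with nonnegative weights gives a valid
  inequality, so every sketched half-space contains \<open>X\<close>.\<close>

lemma res_feasible:
  assumes "i \<in> {1..q}" "y \<in> X"
  shows "res i y \<le> 0"
  unfolding res_def scalar_prod_def
  using assms sketch_nonneg[OF assms(1)]
  by (intro sum_nonpos) (auto simp: feasible_set_def intro!: mult_nonneg_nonpos)

lemma ip_grad:
  assumes "i \<in> {1..q}" "x \<in> carrier_vec n" "y \<in> carrier_vec n"
  shows "ip (grad i z) (x - y) = pos_part (res i z) / weight i * (res i x - res i y)"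
  using assms by (simp add: grad_eq ip_smult_left ip_inv_B_left res_diff)

lemma sqn_grad:
  assumes "i \<in> {1..q}"
  shows "sqn (grad i x) = 2 * loss i x"
proof -
  have "ip (inv_mat B *\<^sub>v normal i) (inv_mat B *\<^sub>v normal i) = weight i"
    using sqn_inv_B[of "normal i"] by (simp add: sqn_ip weight_def)
  then show ?thesis
    using weight_pos[OF assms]
    by (simp add: sqn_ip grad_eq ip_smult_left ip_smult_right loss_eq[unfolded sqn_ip] power2_eq_square)
qed

text \<open>Twice what convexity alone gives at a feasible point, where the loss vanishes: the loss
  is quadratic in the positive residual, and the residual of \<open>y\<close> has a favourable
  sign.\<close>

lemma ip_grad_feasible:
  assumes "i \<in> {1..q}" "x \<in> carrier_vec n" "y \<in> X"
  shows "2 * loss i x \<le> ip (grad i x) (x - y)"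
proof -
  have "2 * loss i x = pos_part (res i x) / weight i * res i x"
    using weight_pos[OF assms(1)] by (simp add: loss_eq pos_part_def power2_eq_square max_def)
  also have "\<dots> \<le> pos_part (res i x) / weight i * (res i x - res i y)"
    using weight_pos[OF assms(1)] res_feasible[OF assms(1,3)]
    by (intro mult_left_mono) (auto simp: pos_part_def)
  also have "\<dots> = ip (grad i x) (x - y)"
    using assms X_carrier by (subst ip_grad) auto
  finally show ?thesis .
qed

text \<open>The loss is a scalar function of an affine residual, so the gradient inequality for the
  squared positive part suffices; that one comes from expanding the square of a difference of
  positive parts.\<close>

lemma loss_convex:
  assumes "i \<in> {1..q}" "x \<in> carrier_vec n" "y \<in> carrier_vec n"
  shows "loss i x - loss i y \<le> ip (grad i x) (x - y)"
proof -
  have *: "(pos_part s)\<^sup>2 - (pos_part t)\<^sup>2 \<le> 2 * (pos_part s * (s - t))" for s t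
  proof -
    have "0 \<le> (pos_part s - pos_part t)\<^sup>2" by simp
    moreover have "pos_part s * s = (pos_part s)\<^sup>2"
      by (simp add: pos_part_def max_def power2_eq_square)
    moreover have "pos_part s * t \<le> pos_part s * pos_part t"
      by (intro mult_left_mono) (auto simp: pos_part_def)
    ultimately show ?thesis by (simp add: power2_diff right_diff_distrib)
  qed
  have "loss i x - loss i y = ((pos_part (res i x))\<^sup>2 - (pos_part (res i y))\<^sup>2) / (2 * weight i)"
    by (simp add: loss_eq diff_divide_distrib)
  also have "\<dots> \<le> (2 * (pos_part (res i x) * (res i x - res i y))) / (2 * weight i)"
    using weight_pos[OF assms(1)] by (intro divide_right_mono *) auto
  also have "\<dots> = ip (grad i x) (x - y)"
    using assms by (simp add: ip_grad)
  finally show ?thesis .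
qed

text \<open>\<open>x\<close> is the current and \<open>z\<close> the previous iterate. The index is
  an argument, so that it can be averaged while both points stay fixed.\<close>

definition momentum_step :: "real \<Rightarrow> real \<Rightarrow> nat \<Rightarrow> rvec \<Rightarrow> rvec \<Rightarrow> rvec" where
  "momentum_step \<delta> \<gamma> i x z = x - \<delta> \<cdot>\<^sub>v grad i x + \<gamma> \<cdot>\<^sub>v (x - z)"

lemma momentum_step_carrier [simp]:
  "x \<in> carrier_vec n \<Longrightarrow> z \<in> carrier_vec n \<Longrightarrow> momentum_step \<delta> \<gamma> i x z \<in> carrier_vec n"
  by (simp add: momentum_step_def)

text \<open>The increment is the old one scaled by \<open>\<gamma>\<close> minus the gradient part.
  Convexity bounds the cross term and brings in the loss at the previous iterate.\<close>

lemma increment_momentum_step: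
  assumes i: "i \<in> {1..q}" and x: "x \<in> carrier_vec n" and z: "z \<in> carrier_vec n"
    and \<delta>: "0 \<le> \<delta>" and \<gamma>: "0 \<le> \<gamma>"
  shows "sqn (momentum_step \<delta> \<gamma> i x z - x) \<le>
    \<gamma>\<^sup>2 * sqn (x - z) + (2 * \<delta>\<^sup>2 - 2 * \<gamma> * \<delta>) * loss i x + 2 * \<gamma> * \<delta> * loss i z"
proof -
  let ?g = "grad i x"
  have "momentum_step \<delta> \<gamma> i x z - x = \<gamma> \<cdot>\<^sub>v (x - z) - \<delta> \<cdot>\<^sub>v ?g"
    using carrier_vecD[OF x] carrier_vecD[OF z]
    unfolding momentum_step_def by (intro eq_vecI) auto
  then have "sqn (momentum_step \<delta> \<gamma> i x z - x) =
      \<gamma>\<^sup>2 * sqn (x - z) + \<delta>\<^sup>2 * sqn ?g - 2 * \<gamma> * \<delta> * ip ?g (x - z)"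
    using x z ip_commute[of x ?g] ip_commute[of z ?g]
    by (simp add: sqn_ip ip_linear algebra_simps power2_eq_square)
  also have "\<dots> \<le> \<gamma>\<^sup>2 * sqn (x - z) + \<delta>\<^sup>2 * (2 * loss i x) - 2 * \<gamma> * \<delta> * (loss i x - loss i z)"
    unfolding sqn_grad[OF i] using loss_convex[OF i x z] \<delta> \<gamma>
    by (intro diff_left_mono mult_left_mono) auto
  finally show ?thesis by (simp add: algebra_simps)
qed

lemma dsq_momentum_step:
  assumes i: "i \<in> {1..q}" and x: "x \<in> carrier_vec n" and z: "z \<in> carrier_vec n"
    and \<delta>: "0 \<le> \<delta>" and \<gamma>: "0 \<le> \<gamma>"
  shows "dsq (momentum_step \<delta> \<gamma> i x z) \<le>
    (1 + \<gamma>) * dsq x - \<gamma> * dsq z + \<gamma> * (1 + \<gamma>) * sqn (x - z)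
    - (4 * \<delta> - 2 * \<delta>\<^sup>2 + 2 * \<gamma> * \<delta>) * loss i x + 2 * \<gamma> * \<delta> * loss i z"
    (is "dsq ?x' \<le> ?rhs")
proof (rule field_le_epsilon)
  fix e :: real assume e: "0 < e"
  \<comment> \<open>The error of the near-minimiser gets multiplied by \<open>1 + \<gamma>\<close>
    below.\<close>
  then have e': "0 < e / (1 + \<gamma>)" using \<gamma> by simp
  let ?g = "grad i x"
  obtain y where y: "y \<in> X" "sqn (x - y) < dsq x + e / (1 + \<gamma>)"
    using dist_wrt_sq_approx[OF feasible X_carrier x e'] .
  have yc: "y \<in> carrier_vec n" using y X_carrier by auto
  have "?x' - y = ((x - y) + \<gamma> \<cdot>\<^sub>v (x - z)) - \<delta> \<cdot>\<^sub>v ?g"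
    using carrier_vecD[OF x] carrier_vecD[OF z] carrier_vecD[OF yc]
     
    unfolding momentum_step_def by (intro eq_vecI) auto
  \<comment> \<open>The first three terms are the squared norm of the extrapolated point
    \<open>(1 + \<gamma>) (x - y) - \<gamma> (z - y)\<close>, the identity of
    \<open>sqn_convex_combination\<close> with parameter \<open>- \<gamma>\<close>.\<close>
  then have "sqn (?x' - y) = (1 + \<gamma>) * sqn (x - y) - \<gamma> * sqn (z - y) + \<gamma> * (1 + \<gamma>) * sqn (x - z)
      + \<delta>\<^sup>2 * sqn ?g - 2 * \<delta> * ip ?g (x - y) - 2 * \<gamma> * \<delta> * ip ?g (x - z)"
    using x z yc ip_commute[of x ?g] ip_commute[of z ?g] ip_commute[of y ?g]
      ip_commute[of z x] ip_commute[of y x] ip_commute[of z y]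
    by (simp add: sqn_ip ip_linear algebra_simps power2_eq_square)
  \<comment> \<open>The term in \<open>z\<close> enters negatively, so any \<open>y\<close> in
    \<open>X\<close> serves there; near-minimality is needed for \<open>x\<close> only.\<close>
  also have "\<dots> \<le> (1 + \<gamma>) * (dsq x + e / (1 + \<gamma>)) - \<gamma> * dsq z + \<gamma> * (1 + \<gamma>) * sqn (x - z)
      + \<delta>\<^sup>2 * sqn ?g - 2 * \<delta> * (2 * loss i x) - 2 * \<gamma> * \<delta> * (loss i x - loss i z)"
    using loss_convex[OF i x z] ip_grad_feasible[OF i x y(1)] \<delta> \<gamma>
      dist_wrt_sq_le[OF X_carrier z y(1)] y(2)
    by (intro add_mono diff_mono mult_left_mono) auto
  also have "\<dots> = ?rhs + e"
    unfolding sqn_grad[OF i] using \<gamma> by (simp add: field_simps)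
  finally have "sqn (?x' - y) \<le> ?rhs + e" .
  moreover have "dsq ?x' \<le> sqn (?x' - y)"
    using x z y by (intro dist_wrt_sq_le X_carrier) auto
  ultimately show "dsq ?x' \<le> ?rhs + e" by simp
qed

section \<open>Averaging one step over the sampling rule\<close>

lemma sampled_indices: "x \<in> carrier_vec n \<Longrightarrow> set_pmf (R x) \<subseteq> {1..q}"
  using rule by (auto simp: sampling_rule_def)

lemma integrable_rule: "x \<in> carrier_vec n \<Longrightarrow> integrable (measure_pmf (R x)) (h :: nat \<Rightarrow> real)"
  using sampled_indices[of x] by (intro integrable_measure_pmf_finite) (auto intro: finite_subset)

lemma rule_expectation_mono:
  assumes "x \<in> carrier_vec n" "\<And>i. i \<in> {1..q} \<Longrightarrow> g i \<le> (h i :: real)"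
  shows "measure_pmf.expectation (R x) g \<le> measure_pmf.expectation (R x) h"
  using assms sampled_indices[OF assms(1)]
  by (intro integral_mono_AE integrable_rule) (auto simp: AE_measure_pmf_iff)

text \<open>Adding \<open>\<zeta>\<close> times the squared increment to the squared distance is what produces the
  factor \<open>2 / (1 + \<zeta>) - \<delta> + \<gamma>\<close> of the hypotheses.\<close>

lemma expected_momentum_step:
  assumes x: "x \<in> carrier_vec n" and z: "z \<in> carrier_vec n"
    and \<delta>: "0 \<le> \<delta>" and \<gamma>: "0 \<le> \<gamma>" and \<zeta>: "0 \<le> \<zeta>"
    and K: "K = 2 / (1 + \<zeta>) - \<delta> + \<gamma>" "0 \<le> K"
    and lower: "\<mu>1 / 2 * dsq x \<le> loss_drawn_at B A b S R x x"
    and upper: "loss_drawn_at B A b S R x z \<le> \<mu>2 / 2 * dsq z"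
  shows "measure_pmf.expectation (R x)
      (\<lambda>i. dsq (momentum_step \<delta> \<gamma> i x z) + \<zeta> * sqn (momentum_step \<delta> \<gamma> i x z - x)) \<le>
    (1 + \<gamma> - \<delta> * \<mu>1 * (1 + \<zeta>) * K) * dsq x + (\<gamma> * \<delta> * (1 + \<zeta>) * \<mu>2 - \<gamma>) * dsq z
      + (\<gamma> + \<gamma>\<^sup>2 * (1 + \<zeta>)) * sqn (x - z)"
proof -
  define c where "c = (1 + \<gamma>) * dsq x - \<gamma> * dsq z + (\<gamma> + \<gamma>\<^sup>2 * (1 + \<zeta>)) * sqn (x - z)"
  \<comment> \<open>Up to the factor \<open>2 * \<delta>\<close>, this is minus the total
    coefficient of \<open>loss i x\<close> in the two combined bounds.\<close>
  have K': "(1 + \<zeta>) * K = 2 - (\<delta> - \<gamma>) * (1 + \<zeta>)"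
    using \<zeta> unfolding K(1) by (simp add: field_simps)
  have "measure_pmf.expectation (R x)
      (\<lambda>i. dsq (momentum_step \<delta> \<gamma> i x z) + \<zeta> * sqn (momentum_step \<delta> \<gamma> i x z - x)) \<le>
    measure_pmf.expectation (R x)
      (\<lambda>i. (c - (2 * \<delta> * (1 + \<zeta>) * K) * loss i x) + (2 * \<gamma> * \<delta> * (1 + \<zeta>)) * loss i z)"
  proof (rule rule_expectation_mono[OF x])
    fix i assume i: "i \<in> {1..q}"
    have "dsq (momentum_step \<delta> \<gamma> i x z) + \<zeta> * sqn (momentum_step \<delta> \<gamma> i x z - x) \<le>
      ((1 + \<gamma>) * dsq x - \<gamma> * dsq z + \<gamma> * (1 + \<gamma>) * sqn (x - z)
        - (4 * \<delta> - 2 * \<delta>\<^sup>2 + 2 * \<gamma> * \<delta>) * loss i x + 2 * \<gamma> * \<delta> * loss i z)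
      + \<zeta> * (\<gamma>\<^sup>2 * sqn (x - z) + (2 * \<delta>\<^sup>2 - 2 * \<gamma> * \<delta>) * loss i x + 2 * \<gamma> * \<delta> * loss i z)"
      using dsq_momentum_step[OF i x z \<delta> \<gamma>] increment_momentum_step[OF i x z \<delta> \<gamma>] \<zeta>
      by (intro add_mono mult_left_mono) auto
    also have "\<dots> = c - (2 * \<delta> * ((1 + \<zeta>) * K)) * loss i x + (2 * \<gamma> * \<delta> * (1 + \<zeta>)) * loss i z"
      unfolding K' c_def by (simp add: algebra_simps power2_eq_square)
    finally show "dsq (momentum_step \<delta> \<gamma> i x z) + \<zeta> * sqn (momentum_step \<delta> \<gamma> i x z - x) \<le>
      (c - (2 * \<delta> * (1 + \<zeta>) * K) * loss i x) + (2 * \<gamma> * \<delta> * (1 + \<zeta>)) * loss i z"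
      by (simp add: mult.assoc)
  qed
  also have "\<dots> = c - (2 * \<delta> * (1 + \<zeta>) * K) * loss_drawn_at B A b S R x x
      + (2 * \<gamma> * \<delta> * (1 + \<zeta>)) * loss_drawn_at B A b S R x z"
    unfolding loss_drawn_at_def using integrable_rule[OF x] by simp
  \<comment> \<open>\<open>K\<close> being nonnegative, the lower bound is applied to a term with
    nonpositive coefficient. The loss at \<open>z\<close> is averaged over the law at
    \<open>x\<close>, so \<open>upper\<close> involves two points.\<close>
  also have "\<dots> \<le> c - (2 * \<delta> * (1 + \<zeta>) * K) * (\<mu>1 / 2 * dsq x)
      + (2 * \<gamma> * \<delta> * (1 + \<zeta>)) * (\<mu>2 / 2 * dsq z)"
    using lower upper \<delta> \<gamma> \<zeta> K(2) by (intro add_mono diff_left_mono mult_left_mono) auto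
  finally show ?thesis by (simp add: c_def algebra_simps)
qed

section \<open>Convexity and average iterates\<close>

lemma feasible_convex:
  assumes "p \<in> X" "r \<in> X" "0 \<le> u" "u \<le> 1"
  shows "(1 - u) \<cdot>\<^sub>v p + u \<cdot>\<^sub>v r \<in> X"
proof -
  have c: "p \<in> carrier_vec n" "r \<in> carrier_vec n" using assms X_carrier by auto
  have "vec_index (A *\<^sub>v ((1 - u) \<cdot>\<^sub>v p + u \<cdot>\<^sub>v r)) i \<le> vec_index b i" if i: "i < m" for i
  proof -
    have row: "row A i \<in> carrier_vec n" using A_carrier i by auto
    have "vec_index (A *\<^sub>v ((1 - u) \<cdot>\<^sub>v p + u \<cdot>\<^sub>v r)) i =
        (1 - u) * vec_index (A *\<^sub>v p) i + u * vec_index (A *\<^sub>v r) i"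
      using i c row by (simp add: scalar_prod_add_distrib[OF row])
    also have "\<dots> \<le> (1 - u) * vec_index b i + u * vec_index b i"
      using assms i by (intro add_mono mult_left_mono) (auto simp: feasible_set_def)
    finally show ?thesis by (simp add: algebra_simps)
  qed
  then show ?thesis using c by (simp add: feasible_set_def)
qed

lemma average_iter_carrier [simp]: "average_iter n y k \<in> carrier_vec n"
  by (simp add: average_iter_def)

text \<open>Jensen's inequality by induction: each average is a convex combination of the preceding
  one and the newest point, the latter with weight \<open>1 / real (Suc k)\<close>.\<close>

lemma dsq_average_iter:
  assumes "\<And>l. y l \<in> carrier_vec n" "1 \<le> k"
  shows "real k * dsq (average_iter n y k) \<le> (\<Sum>l = 1..k. dsq (y l))"
  using assms(2)
proof (induction k rule: dec_induct)
  case base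
  have "average_iter n y 1 = y 1"
    using carrier_vecD[OF assms(1)[of 1]] by (intro eq_vecI) (auto simp: average_iter_def)
  then show ?case by simp
next
  case (step k)
  define u where "u = 1 / real (Suc k)"
  have u: "0 \<le> u" "u \<le> 1" "real (Suc k) * (1 - u) = real k" "real (Suc k) * u = 1"
    by (auto simp: u_def field_simps)
  have "average_iter n y (Suc k) = (1 - u) \<cdot>\<^sub>v average_iter n y k + u \<cdot>\<^sub>v y (Suc k)"
  proof (intro eq_vecI)
    fix j assume "j < dim_vec ((1 - u) \<cdot>\<^sub>v average_iter n y k + u \<cdot>\<^sub>v y (Suc k))"
    then have j: "j < n" using carrier_vecD[OF assms(1)] by simp
    have k: "(1 - u) * (1 / real k) = u"
      using step.hyps by (simp add: u_def field_simps)
    have "vec_index ((1 - u) \<cdot>\<^sub>v average_iter n y k + u \<cdot>\<^sub>v y (Suc k)) j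
        = ((1 - u) * (1 / real k)) * (\<Sum>l = 1..k. vec_index (y l) j) + u * vec_index (y (Suc k)) j"
      using j carrier_vecD[OF assms(1)] by (simp add: average_iter_def)
    also have "\<dots> = vec_index (average_iter n y (Suc k)) j"
      unfolding k using j by (simp add: average_iter_def u_def distrib_left)
    finally show "vec_index (average_iter n y (Suc k)) j =
      vec_index ((1 - u) \<cdot>\<^sub>v average_iter n y k + u \<cdot>\<^sub>v y (Suc k)) j" by simp
  qed (use carrier_vecD[OF assms(1)] in \<open>simp add: average_iter_def\<close>)
  then have "real (Suc k) * dsq (average_iter n y (Suc k)) \<le>
      real (Suc k) * ((1 - u) * dsq (average_iter n y k) + u * dsq (y (Suc k)))"
    using dist_wrt_sq_convex[OF feasible X_carrier feasible_convex average_iter_carrier assms(1), of u]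
      u by (intro mult_left_mono) auto
  also have "\<dots> = (real (Suc k) * (1 - u)) * dsq (average_iter n y k) + (real (Suc k) * u) * dsq (y (Suc k))"
    by (simp only: distrib_left mult.assoc)
  also have "\<dots> \<le> (\<Sum>l = 1..k. dsq (y l)) + dsq (y (Suc k))"
    unfolding u using step.IH by simp
  finally show ?case by simp
qed

end

section \<open>Expectations along the random index sequence\<close>

text \<open>Sum and integral of nonnegative terms may be exchanged, so the series has finite
  expectation and is finite almost surely.\<close>

lemma AE_summable_if_summable_expectation:
  fixes f :: "nat \<Rightarrow> 'a \<Rightarrow> real"
  assumes int: "\<And>k. integrable M (f k)" and nonneg: "\<And>k \<omega>. 0 \<le> f k \<omega>"
    and bound: "\<And>k. (\<integral>\<omega>. f k \<omega> \<partial>M) \<le> g k" and g: "summable g"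
  shows "AE \<omega> in M. summable (\<lambda>k. f k \<omega>)"
proof -
  have g0: "0 \<le> g k" for k
    using bound[of k] Bochner_Integration.integral_nonneg[of M "f k"] nonneg by (meson order_trans)
  have "(\<integral>\<^sup>+\<omega>. (\<Sum>k. ennreal (f k \<omega>)) \<partial>M) = (\<Sum>k. \<integral>\<^sup>+\<omega>. ennreal (f k \<omega>) \<partial>M)"
    using int by (intro nn_integral_suminf) auto
  also have "\<dots> = (\<Sum>k. ennreal (\<integral>\<omega>. f k \<omega> \<partial>M))"
    using int nonneg by (simp add: nn_integral_eq_integral)
  also have "\<dots> \<le> (\<Sum>k. ennreal (g k))"
    using bound by (intro suminf_le ennreal_leI) auto
  also have "\<dots> < \<infinity>"
    using suminf_ennreal2[OF g0 g] by simp
  finally have "AE \<omega> in M. (\<Sum>k. ennreal (f k \<omega>)) \<noteq> \<infinity>"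
    using int by (intro nn_integral_noteq_infinite) auto
  then show ?thesis
    by eventually_elim (intro summable_suminf_not_top nonneg, simp)
qed

lemma convergent_if_summable_increments:
  fixes f :: "nat \<Rightarrow> real"
  assumes "summable (\<lambda>k. \<bar>f (Suc k) - f k\<bar>)"
  shows "convergent f"
proof -
  have "convergent (\<lambda>k. \<Sum>l<k. f (Suc l) - f l)"
    using summable_rabs_cancel[OF assms] by (simp add: summable_iff_convergent)
  then have "convergent (\<lambda>k. (f k - f 0) + f 0)"
    unfolding sum_lessThan_telescope by (intro convergent_add convergent_const)
  then show ?thesis by simp
qed

text \<open>A concrete form of measurability with respect to the past. The bound is strict because
  iterate \<open>k\<close> uses only indices below \<open>k\<close>; index 0 is never drawn.\<close>

definition depends_before :: "nat \<Rightarrow> ((nat \<Rightarrow> nat) \<Rightarrow> 'a) \<Rightarrow> bool" where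
  "depends_before k \<Phi> \<longleftrightarrow> (\<forall>\<omega> \<omega>'. (\<forall>l \<in> {1..<k}. \<omega> l = \<omega>' l) \<longrightarrow> \<Phi> \<omega> = \<Phi> \<omega>')"

lemma depends_beforeD:
  "depends_before k \<Phi> \<Longrightarrow> (\<And>l. l \<in> {1..<k} \<Longrightarrow> \<omega> l = \<omega>' l) \<Longrightarrow> \<Phi> \<omega> = \<Phi> \<omega>'"
  by (auto simp: depends_before_def)

lemma depends_before_mono: "depends_before k \<Phi> \<Longrightarrow> k \<le> k' \<Longrightarrow> depends_before k' \<Phi>"
  by (auto simp: depends_before_def)

text \<open>The function factors through the restriction to finitely many coordinates, where the
  product sigma-algebra is discrete.\<close>

lemma measurable_depends_before:
  fixes \<Phi> :: "(nat \<Rightarrow> nat) \<Rightarrow> real"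
  assumes "depends_before k \<Phi>"
  shows "\<Phi> \<in> borel_measurable (Pi\<^sub>M UNIV (\<lambda>_. count_space UNIV))"
proof -
  let ?I = "{1..<k}"
  have "(\<lambda>\<omega>. restrict \<omega> ?I) \<in> measurable (Pi\<^sub>M UNIV (\<lambda>_. count_space UNIV)) (Pi\<^sub>M ?I (\<lambda>_. count_space (UNIV :: nat set)))"
    by (rule measurable_restrict_subset) simp
  also have "Pi\<^sub>M ?I (\<lambda>_. count_space (UNIV :: nat set)) = count_space (Pi\<^sub>E ?I (\<lambda>_. UNIV))"
    by (rule count_space_PiM_finite) auto
  finally have "(\<lambda>\<omega>. \<Phi> (restrict \<omega> ?I)) \<in> borel_measurable (Pi\<^sub>M UNIV (\<lambda>_. count_space UNIV))"
    by (rule measurable_compose) simp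
  also have "(\<lambda>\<omega>. \<Phi> (restrict \<omega> ?I)) = \<Phi>"
    by (intro ext depends_beforeD[OF assms]) simp
  finally show ?thesis .
qed

locale momentum_method = sketched_system n B m q A b S R + prob_space P
  for n B m q A b S R and P :: "(nat \<Rightarrow> nat) measure" +
  fixes \<delta> \<gamma> :: real and x0 :: rvec
  assumes x0_carrier: "x0 \<in> carrier_vec n"
    and sets_P: "sets P = sets (Pi\<^sub>M UNIV (\<lambda>_. count_space UNIV))"
    and law: "1 \<le> k \<Longrightarrow>
      measure P {\<omega> \<in> space P. \<forall>l \<in> {1..k}. \<omega> l = h l} =
      measure P {\<omega> \<in> space P. \<forall>l \<in> {1..<k}. \<omega> l = h l}
        * pmf (R (momentum_iter B A b S \<delta> \<gamma> x0 h k)) (h k)"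
begin

abbreviation iter :: "(nat \<Rightarrow> nat) \<Rightarrow> nat \<Rightarrow> rvec" where
  "iter \<equiv> momentum_iter B A b S \<delta> \<gamma> x0"

lemma iter_Suc:
  "iter \<omega> (Suc (Suc k)) = momentum_step \<delta> \<gamma> (\<omega> (Suc k)) (iter \<omega> (Suc k)) (iter \<omega> k)"
  by (simp add: momentum_step_def)

lemma iter_carrier [simp]: "iter \<omega> k \<in> carrier_vec n"
proof (induction k rule: induct_nat_012)
  case (ge2 k)
  then show ?case unfolding iter_Suc by (intro momentum_step_carrier)
qed (simp_all add: x0_carrier)

lemma iter_dim [simp]: "dim_vec (iter \<omega> k) = n"
  using iter_carrier by (rule carrier_vecD)

lemma iter_depends_before: "depends_before k (\<lambda>\<omega>. iter \<omega> k)"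
proof (induction k rule: induct_nat_012)
  case (ge2 k)
  show ?case unfolding depends_before_def
  proof (intro allI impI)
    fix \<omega> \<omega>' :: "nat \<Rightarrow> nat" assume "\<forall>l \<in> {1..<Suc (Suc k)}. \<omega> l = \<omega>' l"
    then have eq: "\<omega> l = \<omega>' l" if "l \<in> {1..<Suc (Suc k)}" for l using that by blast
    have "iter \<omega> k = iter \<omega>' k" "iter \<omega> (Suc k) = iter \<omega>' (Suc k)"
      by (intro depends_beforeD[OF ge2(1)] depends_beforeD[OF ge2(2)] eq; simp)+
    moreover have "\<omega> (Suc k) = \<omega>' (Suc k)" by (intro eq) simp
    ultimately show "iter \<omega> (Suc (Suc k)) = iter \<omega>' (Suc (Suc k))"
      unfolding iter_Suc by simp
  qed
qed (simp_all add: depends_before_def)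

lemma iter_eq:
  assumes "\<And>l. l \<in> {1..<k} \<Longrightarrow> \<omega> l = \<omega>' l" "j \<le> k"
  shows "iter \<omega> j = iter \<omega>' j"
  using depends_beforeD[OF depends_before_mono[OF iter_depends_before assms(2)]] assms(1) by blast

lemma iter_update: "j \<le> k \<Longrightarrow> iter (fun_upd \<omega> k i) j = iter \<omega> j"
  by (intro iter_eq[of k]) auto

section \<open>Finite histories and conditioning on the past\<close>

lemma space_P: "space P = UNIV"
  using sets_eq_imp_space_eq[OF sets_P] by (simp add: space_PiM)

lemma measurable_P:
  fixes \<Phi> :: "(nat \<Rightarrow> nat) \<Rightarrow> real"
  shows "depends_before k \<Phi> \<Longrightarrow> \<Phi> \<in> borel_measurable P"
  using measurable_depends_before measurable_cong_sets[OF sets_P refl] by blast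

definition cylinder :: "nat \<Rightarrow> (nat \<Rightarrow> nat) \<Rightarrow> (nat \<Rightarrow> nat) set" where
  "cylinder k h = {\<omega>. \<forall>l \<in> {1..<k}. \<omega> l = h l}"

text \<open>Extensional functions give one representative per history, so distinct histories have
  disjoint cylinders.\<close>

definition histories :: "nat \<Rightarrow> (nat \<Rightarrow> nat) set" where
  "histories k = Pi\<^sub>E {1..<k} (\<lambda>_. {1..q})"

lemma finite_histories: "finite (histories k)"
  by (simp add: histories_def finite_PiE)

lemma sets_cylinder: "cylinder k h \<in> sets P"
proof -
  have "depends_before k (\<lambda>\<omega>. indicator (cylinder k h) \<omega> :: real)"
    by (auto simp: depends_before_def cylinder_def indicator_def)
  from measurable_P[OF this] show ?thesis
    by (simp add: borel_measurable_indicator_iff space_P)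
qed

lemma measure_cylinder_Suc:
  assumes "1 \<le> k"
  shows "measure P (cylinder (Suc k) h) = measure P (cylinder k h) * pmf (R (iter h k)) (h k)"
proof -
  have "cylinder (Suc k) h = {\<omega> \<in> space P. \<forall>l \<in> {1..k}. \<omega> l = h l}"
    by (simp add: cylinder_def space_P atLeastLessThanSuc_atLeastAtMost)
  moreover have "cylinder k h = {\<omega> \<in> space P. \<forall>l \<in> {1..<k}. \<omega> l = h l}"
    by (simp add: cylinder_def space_P)
  ultimately show ?thesis using law[OF assms] by simp
qed

text \<open>The law speaks about single cylinders only. Those ending in an index outside the range
  are null, and countably many of them cover the exceptional event.\<close>

lemma AE_index_in_range:
  assumes "1 \<le> l"
  shows "AE \<omega> in P. \<omega> l \<in> {1..q}"
proof -
  let ?N = "{h \<in> Pi\<^sub>E {1..<Suc l} (\<lambda>_. UNIV). h l \<notin> {1..q}}"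
  have "AE \<omega> in P. \<omega> \<notin> cylinder (Suc l) h" if "h \<in> ?N" for h
  proof -
    have "pmf (R (iter h l)) (h l) = 0"
      using that sampled_indices[OF iter_carrier, of h l] by (auto simp: pmf_eq_0_set_pmf)
    then have "measure P (cylinder (Suc l) h) = 0"
      by (simp add: measure_cylinder_Suc[OF assms])
    then show ?thesis
      using sets_cylinder by (intro AE_not_in) (simp add: null_sets_def emeasure_eq_measure)
  qed
  moreover have "countable ?N"
    by (rule countable_subset[of _ "Pi\<^sub>E {1..<Suc l} (\<lambda>_. UNIV)"]) (auto intro: countable_PiE)
  ultimately have "AE \<omega> in P. \<forall>h \<in> ?N. \<omega> \<notin> cylinder (Suc l) h"
    by (subst AE_ball_countable) auto
  then show ?thesis
  proof eventually_elim
    case (elim \<omega>)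
    have "\<omega> \<in> cylinder (Suc l) (restrict \<omega> {1..<Suc l})"
      by (auto simp: cylinder_def)
    then have "restrict \<omega> {1..<Suc l} \<notin> ?N" using elim by blast
    then show ?case using assms by auto
  qed
qed

text \<open>Almost every index sequence lies in exactly one of the finitely many cylinders, on which
  the function is constant. Hence it is almost surely simple, and integrability needs no
  bound.\<close>

lemma expectation_histories:
  fixes \<Phi> :: "(nat \<Rightarrow> nat) \<Rightarrow> real"
  assumes \<Phi>: "depends_before k \<Phi>"
  shows "integrable P \<Phi>"
    and "(\<integral>\<omega>. \<Phi> \<omega> \<partial>P) = (\<Sum>h\<in>histories k. measure P (cylinder k h) * \<Phi> h)"
proof -
  let ?\<Psi> = "\<lambda>\<omega>. \<Sum>h\<in>histories k. \<Phi> h * indicator (cylinder k h) \<omega>"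
  have "AE \<omega> in P. \<forall>l \<in> {1..<k}. \<omega> l \<in> {1..q}"
    by (subst AE_ball_countable) (auto intro!: AE_index_in_range[simplified])
  then have eq: "AE \<omega> in P. \<Phi> \<omega> = ?\<Psi> \<omega>"
  proof eventually_elim
    case (elim \<omega>)
    let ?h = "restrict \<omega> {1..<k}"
    have h: "?h \<in> histories k" using elim by (auto simp: histories_def)
    have "?\<Psi> \<omega> = (\<Sum>h\<in>histories k. if h = ?h then \<Phi> h else 0)"
    proof (intro sum.cong refl)
      fix h assume "h \<in> histories k"
      then have "\<omega> \<in> cylinder k h \<longleftrightarrow> h = ?h"
        by (auto simp: cylinder_def histories_def fun_eq_iff PiE_def extensional_def restrict_def)
      then show "\<Phi> h * indicator (cylinder k h) \<omega> = (if h = ?h then \<Phi> h else 0)"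
        by (simp add: indicator_def)
    qed
    also have "\<dots> = \<Phi> ?h" using h finite_histories by simp
    also have "\<dots> = \<Phi> \<omega>" by (intro depends_beforeD[OF \<Phi>]) simp
    finally show ?case by simp
  qed
  have int: "integrable P (\<lambda>\<omega>. \<Phi> h * indicator (cylinder k h) \<omega>)" for h
    using sets_cylinder by (intro integrable_mult_right) (auto simp: emeasure_eq_measure)
  then have int': "integrable P ?\<Psi>" by auto
  then show "integrable P \<Phi>"
    using integrable_cong_AE[OF measurable_P[OF \<Phi>] _ eq] by auto
  have "(\<integral>\<omega>. \<Phi> \<omega> \<partial>P) = (\<integral>\<omega>. ?\<Psi> \<omega> \<partial>P)"
    using int' by (intro integral_cong_AE eq measurable_P[OF \<Phi>]) auto
  also have "\<dots> = (\<Sum>h\<in>histories k. \<Phi> h * measure P (cylinder k h))"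
    using int by (simp add: space_P)
  finally show "(\<integral>\<omega>. \<Phi> \<omega> \<partial>P) = (\<Sum>h\<in>histories k. measure P (cylinder k h) * \<Phi> h)"
    by (simp add: mult.commute)
qed

text \<open>The tower property: given the earlier indices, index \<open>k\<close> follows the rule
  at the current iterate, and \<open>fun_upd\<close> inserts it. A history before
  \<open>Suc k\<close> splits into a history before \<open>k\<close> and one further index.\<close>

lemma expectation_condition_on_past:
  fixes \<Phi> :: "(nat \<Rightarrow> nat) \<Rightarrow> real"
  assumes k: "1 \<le> k" and \<Phi>: "depends_before (Suc k) \<Phi>"
  shows "depends_before k (\<lambda>\<omega>. measure_pmf.expectation (R (iter \<omega> k)) (\<lambda>i. \<Phi> (fun_upd \<omega> k i)))"
    (is "depends_before k ?\<Psi>")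
    and "(\<integral>\<omega>. \<Phi> \<omega> \<partial>P) =
      (\<integral>\<omega>. measure_pmf.expectation (R (iter \<omega> k)) (\<lambda>i. \<Phi> (fun_upd \<omega> k i)) \<partial>P)"
proof -
  show \<Psi>: "depends_before k ?\<Psi>"
    unfolding depends_before_def
  proof (intro allI impI)
    fix \<omega> \<omega>' :: "nat \<Rightarrow> nat" assume eq: "\<forall>l \<in> {1..<k}. \<omega> l = \<omega>' l"
    then have "iter \<omega> k = iter \<omega>' k" by (intro iter_eq[of k]) auto
    moreover have "\<Phi> (fun_upd \<omega> k i) = \<Phi> (fun_upd \<omega>' k i)" for i
      using eq by (intro depends_beforeD[OF \<Phi>]) auto
    ultimately show "?\<Psi> \<omega> = ?\<Psi> \<omega>'" by simp
  qed
  have H: "histories (Suc k) = (\<lambda>(i, h). fun_upd h k i) ` ({1..q} \<times> histories k)"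
    unfolding histories_def using k by (simp add: atLeastLessThanSuc PiE_insert_eq)
  have inj: "inj_on (\<lambda>(i, h). fun_upd h k i) ({1..q} \<times> histories k)"
    unfolding histories_def by (intro inj_combinator) auto
  \<comment> \<open>The cylinder before \<open>k\<close> and iterate \<open>k\<close> ignore
    coordinate \<open>k\<close>, so the update affects only the last factor of the law.\<close>
  have W: "measure P (cylinder (Suc k) (fun_upd h k i)) = measure P (cylinder k h) * pmf (R (iter h k)) i" for h i
  proof -
    have "cylinder k (fun_upd h k i) = cylinder k h" by (auto simp: cylinder_def)
    then show ?thesis using measure_cylinder_Suc[OF k, of "fun_upd h k i"] by (simp add: iter_update)
  qed
  have "(\<integral>\<omega>. \<Phi> \<omega> \<partial>P) = (\<Sum>h\<in>histories (Suc k). measure P (cylinder (Suc k) h) * \<Phi> h)"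
    by (rule expectation_histories(2)[OF \<Phi>])
  also have "\<dots> = (\<Sum>(i, h)\<in>{1..q} \<times> histories k.
      measure P (cylinder k h) * (\<Phi> (fun_upd h k i) * pmf (R (iter h k)) i))"
    unfolding H sum.reindex[OF inj] by (intro sum.cong) (auto simp: W)
  also have "\<dots> = (\<Sum>i\<in>{1..q}. \<Sum>h\<in>histories k.
      measure P (cylinder k h) * (\<Phi> (fun_upd h k i) * pmf (R (iter h k)) i))"
    by (rule sum.cartesian_product[symmetric])
  also have "\<dots> = (\<Sum>h\<in>histories k. \<Sum>i\<in>{1..q}.
      measure P (cylinder k h) * (\<Phi> (fun_upd h k i) * pmf (R (iter h k)) i))"
    by (rule sum.swap)
  also have "\<dots> = (\<Sum>h\<in>histories k. measure P (cylinder k h) * ?\<Psi> h)"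
  proof (intro sum.cong refl)
    fix h
    have "?\<Psi> h = (\<Sum>i\<in>{1..q}. \<Phi> (fun_upd h k i) * pmf (R (iter h k)) i)"
      using sampled_indices[OF iter_carrier, of h k] by (intro integral_measure_pmf_real) blast+
    then show "(\<Sum>i\<in>{1..q}. measure P (cylinder k h) * (\<Phi> (fun_upd h k i) * pmf (R (iter h k)) i)) =
        measure P (cylinder k h) * ?\<Psi> h"
      by (simp add: sum_distrib_left)
  qed
  also have "\<dots> = (\<integral>\<omega>. ?\<Psi> \<omega> \<partial>P)"
    by (rule expectation_histories(2)[OF \<Psi>, symmetric])
  finally show "(\<integral>\<omega>. \<Phi> \<omega> \<partial>P) = (\<integral>\<omega>. ?\<Psi> \<omega> \<partial>P)" .
qed

lemma depends_before_iter2: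
  "k \<le> K \<Longrightarrow> l \<le> K \<Longrightarrow> depends_before K (\<lambda>\<omega>. g (iter \<omega> k) (iter \<omega> l))"
  unfolding depends_before_def by (metis iter_eq)

lemma integrable_iter2:
  fixes g :: "rvec \<Rightarrow> rvec \<Rightarrow> real"
  shows "integrable P (\<lambda>\<omega>. g (iter \<omega> k) (iter \<omega> l))"
  using expectation_histories(1)[OF depends_before_iter2[of k "max k l" l g]] by simp

lemma integrable_iter:
  fixes g :: "rvec \<Rightarrow> real"
  shows "integrable P (\<lambda>\<omega>. g (iter \<omega> k))"
  using integrable_iter2[of "\<lambda>u v. g u" k k] .

lemma depends_before_average_iter:
  "depends_before k (\<lambda>\<omega>. g (average_iter n (iter \<omega>) k))"
  unfolding depends_before_def
proof (intro allI impI)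
  fix \<omega> \<omega>' :: "nat \<Rightarrow> nat" assume eq: "\<forall>l \<in> {1..<k}. \<omega> l = \<omega>' l"
  have "iter \<omega> l = iter \<omega>' l" if "l \<in> {1..k}" for l
    using eq that by (intro iter_eq[of k]) auto
  then have "average_iter n (iter \<omega>) k = average_iter n (iter \<omega>') k"
    by (simp add: average_iter_def)
  then show "g (average_iter n (iter \<omega>) k) = g (average_iter n (iter \<omega>') k)" by simp
qed

lemma integrable_average_iter:
  fixes g :: "rvec \<Rightarrow> real"
  shows "integrable P (\<lambda>\<omega>. g (average_iter n (iter \<omega>) k))"
  by (rule expectation_histories(1)[OF depends_before_average_iter])

text \<open>If squared increments decay in mean at rate \<open>\<rho>\<close>, absolute increments
  of each coordinate decay at rate \<open>sqrt \<rho>\<close> and are almost surely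
  summable.\<close>

lemma AE_converges_iter:
  assumes \<rho>: "0 < \<rho>" "\<rho> < 1" and C: "0 \<le> C"
    and decay: "\<And>k. (\<integral>\<omega>. sqn (iter \<omega> (Suc k) - iter \<omega> k) \<partial>P) \<le> C * \<rho> ^ k"
  shows "AE \<omega> in P. converges_vec n (iter \<omega>)"
proof -
  have "AE \<omega> in P. convergent (\<lambda>k. vec_index (iter \<omega> k) j)" if j: "j < n" for j
  proof -
    obtain D where D: "0 \<le> D" "\<And>v. v \<in> carrier_vec n \<Longrightarrow> (vec_index v j)\<^sup>2 \<le> D * sqn v"
      using coordinate_bound[OF j] by blast
    define \<theta> where "\<theta> = sqrt \<rho>"
    have \<theta>: "0 < \<theta>" "\<theta> < 1" "\<theta> * \<theta> = \<rho>" using \<rho> by (auto simp: \<theta>_def)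
    let ?f = "\<lambda>k \<omega>. \<bar>vec_index (iter \<omega> (Suc k)) j - vec_index (iter \<omega> k) j\<bar>"
    have "AE \<omega> in P. summable (\<lambda>k. ?f k \<omega>)"
    proof (rule AE_summable_if_summable_expectation)
      show "integrable P (?f k)" for k
        by (rule integrable_iter2[of "\<lambda>u v. \<bar>vec_index u j - vec_index v j\<bar>"])
      show "summable (\<lambda>k. (1 + D * C) / 2 * \<theta> ^ k)"
        using \<theta> by (intro summable_mult summable_geometric) auto
      show "(\<integral>\<omega>. ?f k \<omega> \<partial>P) \<le> (1 + D * C) / 2 * \<theta> ^ k" for k
      proof -
        let ?s = "\<lambda>\<omega>. sqn (iter \<omega> (Suc k) - iter \<omega> k)"
        have ints: "integrable P ?s"
          by (rule integrable_iter2[of "\<lambda>u v. sqn (u - v)"])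
        \<comment> \<open>The arithmetic-geometric mean inequality weighted by
          \<open>\<theta> ^ k\<close> replaces Cauchy-Schwarz for integrals: both terms have
          expectation of order \<open>\<theta> ^ k\<close>.\<close>
        have pt: "?f k \<omega> \<le> (\<theta> ^ k + D * ?s \<omega> / \<theta> ^ k) / 2" for \<omega>
        proof -
          let ?t = "?f k \<omega>"
          have "?t\<^sup>2 = (vec_index (iter \<omega> (Suc k) - iter \<omega> k) j)\<^sup>2"
            using j by simp
          also have "\<dots> \<le> D * ?s \<omega>" by (intro D) simp
          finally have t: "?t\<^sup>2 \<le> D * ?s \<omega>" .
          have "2 * ?t * \<theta> ^ k \<le> ?t\<^sup>2 + (\<theta> ^ k)\<^sup>2"
            using sum_squares_bound[of ?t "\<theta> ^ k"] by simp
          also have "\<dots> \<le> D * ?s \<omega> + (\<theta> ^ k)\<^sup>2" using t by simp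
          finally show ?thesis using \<theta> by (simp add: field_simps power2_eq_square)
        qed
        have "(\<integral>\<omega>. ?f k \<omega> \<partial>P) \<le> (\<integral>\<omega>. (\<theta> ^ k + D * ?s \<omega> / \<theta> ^ k) / 2 \<partial>P)"
          using pt ints integrable_iter2[of "\<lambda>u v. \<bar>vec_index u j - vec_index v j\<bar>"]
          by (intro integral_mono) auto
        also have "\<dots> = (\<theta> ^ k + D * (\<integral>\<omega>. ?s \<omega> \<partial>P) / \<theta> ^ k) / 2"
          using ints by (simp add: prob_space)
        also have "\<dots> \<le> (\<theta> ^ k + D * (C * \<rho> ^ k) / \<theta> ^ k) / 2"
          using decay[of k] D(1) \<theta> by (intro divide_right_mono add_left_mono mult_left_mono) auto
        also have "\<dots> = (1 + D * C) / 2 * \<theta> ^ k"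
          using \<theta>(1) unfolding \<theta>(3)[symmetric] power_mult_distrib by (simp add: field_simps)
        finally show ?thesis .
      qed
    qed auto
    then show ?thesis
      by eventually_elim (rule convergent_if_summable_increments)
  qed
  then have "AE \<omega> in P. \<forall>j \<in> {..<n}. convergent (\<lambda>k. vec_index (iter \<omega> k) j)"
    by (subst AE_ball_countable) auto
  then show ?thesis
  proof eventually_elim
    case (elim \<omega>)
    then show ?case
      unfolding converges_vec_def convergent_LIMSEQ_iff
      by (intro bexI[of _ "Matrix.vec n (\<lambda>j. lim (\<lambda>k. vec_index (iter \<omega> k) j))"]) auto
  qed
qed

end

section \<open>Decay of the expected distance\<close>

context sketched_system
begin

text \<open>If \<open>\<mu>2 < \<mu>1\<close>, then every distance to the feasible set would vanish, although some
  loss is positive somewhere.\<close>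

lemma spectral_constants_ordered:
  fixes x0 :: rvec
  assumes spectral: "spectral_constants B A b S R \<mu>1 \<mu>2"
    and upper: "upper_spectral_bound_drawn_anywhere B A b S R \<mu>2"
    and x0_carrier: "x0 \<in> carrier_vec n"
  shows "\<mu>1 \<le> \<mu>2"
proof (rule ccontr)
  assume less: "\<not> \<mu>1 \<le> \<mu>2"
  have zero: "dsq x = 0" if "x \<in> carrier_vec n" for x
  proof -
    have "\<mu>1 / 2 * dsq x \<le> \<mu>2 / 2 * dsq x"
      using spectral that by (force simp: spectral_constants_def)
    then have "(\<mu>1 - \<mu>2) * dsq x \<le> 0" by (simp add: algebra_simps)
    then have "dsq x \<le> 0" using less by (simp add: mult_le_0_iff)
    then show ?thesis by (simp add: order_antisym)
  qed
  obtain i where i: "i \<in> set_pmf (R x0)" using set_pmf_not_empty by fastforce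
  then have iq: "i \<in> {1..q}" using sampled_indices[OF x0_carrier] by auto
  define u where "u = inv_mat B *\<^sub>v normal i"
  \<comment> \<open>\<open>x0\<close> is moved along the representative of the normal until its
    residual equals 1.\<close>
  define y where "y = x0 + ((1 - res i x0) / weight i) \<cdot>\<^sub>v u"
  have u: "u \<in> carrier_vec n" by (simp add: u_def)
  then have y: "y \<in> carrier_vec n" using x0_carrier by (simp add: y_def)
  have "res i y - res i x0 = scalar_prod (normal i) (y - x0)"
    using res_diff[OF iq y x0_carrier] by simp
  also have "y - x0 = ((1 - res i x0) / weight i) \<cdot>\<^sub>v u"
    unfolding y_def using carrier_vecD[OF u] carrier_vecD[OF x0_carrier] by (intro eq_vecI) auto
  also have "scalar_prod (normal i) \<dots> = (1 - res i x0) / weight i * weight i"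
    using u by (subst scalar_prod_smult_distrib[of _ n]) (simp_all add: u_def weight_def sqnorm_wrt_def)
  finally have "res i y = 1" using weight_pos[OF iq] by simp
  then have pos: "loss i y > 0" using weight_pos[OF iq] by (simp add: loss_eq pos_part_def)
  have nonneg: "AE j in measure_pmf (R x0). 0 \<le> loss j y"
    using sampled_indices[OF x0_carrier] by (auto simp: AE_measure_pmf_iff intro!: loss_nonneg)
  \<comment> \<open>The law stays at \<open>x0\<close> while the loss is taken at \<open>y\<close>,
    so the chosen index \<open>i\<close> remains in the support.\<close>
  have "loss_drawn_at B A b S R x0 y \<le> 0"
    using upper x0_carrier y zero[OF y] by (force simp: upper_spectral_bound_drawn_anywhere_def)
  then have "measure_pmf.expectation (R x0) (\<lambda>j. loss j y) = 0"
    using integral_nonneg_AE[OF nonneg] by (simp add: loss_drawn_at_def)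
  then have "AE j in measure_pmf (R x0). loss j y = 0"
    using integral_nonneg_eq_0_iff_AE[OF integrable_rule[OF x0_carrier] nonneg] by simp
  then show False using i pos by (auto simp: AE_measure_pmf_iff)
qed

end

context momentum_method
begin

text \<open>The one-step estimate is integrated after conditioning on the past. The weight
  \<open>\<zeta>\<close> is put into \<open>H\<close>, hence the division by \<open>\<zeta>\<close>
  in the last coefficient.\<close>

lemma Lyapunov_recursion:
  assumes \<delta>: "0 \<le> \<delta>" and \<gamma>: "0 \<le> \<gamma>" and \<zeta>: "0 < \<zeta>"
    and K: "K = 2 / (1 + \<zeta>) - \<delta> + \<gamma>" "0 \<le> K"
    and spectral: "spectral_constants B A b S R \<mu>1 \<mu>2"
    and upper: "upper_spectral_bound_drawn_anywhere B A b S R \<mu>2"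
  defines "F \<equiv> \<lambda>k. \<integral>\<omega>. dsq (iter \<omega> k) \<partial>P"
    and "H \<equiv> \<lambda>k. \<zeta> * (\<integral>\<omega>. sqn (iter \<omega> k - iter \<omega> (k - 1)) \<partial>P)"
  shows "F (k + 2) + H (k + 2) \<le> (1 + \<gamma> - \<delta> * \<mu>1 * (1 + \<zeta>) * K) * F (k + 1)
    + (\<gamma> * \<delta> * (1 + \<zeta>) * \<mu>2 - \<gamma>) * F k + ((\<gamma> + \<gamma>\<^sup>2 * (1 + \<zeta>)) / \<zeta>) * H (k + 1)"
proof -
  let ?a = "1 + \<gamma> - \<delta> * \<mu>1 * (1 + \<zeta>) * K" and ?b = "\<gamma> * \<delta> * (1 + \<zeta>) * \<mu>2 - \<gamma>"
    and ?c = "\<gamma> + \<gamma>\<^sup>2 * (1 + \<zeta>)"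
  define V where "V = (\<lambda>x z. dsq x + \<zeta> * sqn (x - z))"
  let ?\<Phi> = "\<lambda>\<omega>. V (iter \<omega> (Suc (Suc k))) (iter \<omega> (Suc k))"
  let ?\<Psi> = "\<lambda>\<omega>. measure_pmf.expectation (R (iter \<omega> (Suc k))) (\<lambda>i. ?\<Phi> (fun_upd \<omega> (Suc k) i))"
  let ?rhs = "\<lambda>\<omega>. ?a * dsq (iter \<omega> (Suc k)) + ?b * dsq (iter \<omega> k) + ?c * sqn (iter \<omega> (Suc k) - iter \<omega> k)"
  have ints: "integrable P (\<lambda>\<omega>. sqn (iter \<omega> i - iter \<omega> j))" for i j
    by (rule integrable_iter2[of "\<lambda>u v. sqn (u - v)"])
  note intd = integrable_iter[of dsq]
  have \<Phi>: "depends_before (Suc (Suc k)) ?\<Phi>"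
    by (rule depends_before_iter2) auto
  have "F (k + 2) + H (k + 2) = (\<integral>\<omega>. ?\<Phi> \<omega> \<partial>P)"
    using ints intd by (simp add: F_def H_def V_def del: momentum_iter.simps(3))
  also have "\<dots> = (\<integral>\<omega>. ?\<Psi> \<omega> \<partial>P)"
    by (rule expectation_condition_on_past(2)[OF _ \<Phi>]) simp
  also have "\<dots> \<le> (\<integral>\<omega>. ?rhs \<omega> \<partial>P)"
  proof (rule integral_mono)
    show "integrable P ?\<Psi>"
      by (rule expectation_histories(1)[OF expectation_condition_on_past(1)[OF _ \<Phi>]]) simp
    show "integrable P ?rhs" using ints intd by simp
    fix \<omega>
    let ?x = "iter \<omega> (Suc k)" and ?z = "iter \<omega> k"
    \<comment> \<open>Redrawing index \<open>Suc k\<close> changes the newest iterate only.\<close>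
    have upd: "?\<Phi> (fun_upd \<omega> (Suc k) i) = dsq (momentum_step \<delta> \<gamma> i ?x ?z)
        + \<zeta> * sqn (momentum_step \<delta> \<gamma> i ?x ?z - ?x)" for i
      unfolding V_def iter_Suc by (simp only: iter_update[of k "Suc k"] iter_update[of "Suc k" "Suc k"]) simp
    show "?\<Psi> \<omega> \<le> ?rhs \<omega>"
      unfolding upd
    proof (rule expected_momentum_step[OF iter_carrier iter_carrier \<delta> \<gamma> less_imp_le[OF \<zeta>] K])
      show "\<mu>1 / 2 * dsq ?x \<le> loss_drawn_at B A b S R ?x ?x"
        using spectral by (simp add: spectral_constants_def expected_loss_def)
      show "loss_drawn_at B A b S R ?x ?z \<le> \<mu>2 / 2 * dsq ?z"
        using upper by (simp add: upper_spectral_bound_drawn_anywhere_def)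
    qed
  qed
  also have "\<dots> = ?a * F (k + 1) + ?b * F k + ?c * (\<integral>\<omega>. sqn (iter \<omega> (Suc k) - iter \<omega> k) \<partial>P)"
    using ints intd by (simp add: F_def)
  also have "?c * (\<integral>\<omega>. sqn (iter \<omega> (Suc k) - iter \<omega> k) \<partial>P) = ?c / \<zeta> * H (k + 1)"
    using \<zeta> by (simp add: H_def)
  finally show ?thesis .
qed

text \<open>Dropping the increments from \<open>decay\<close> leaves the distance bound; dropping
  the distance leaves what almost sure convergence needs. Losses follow from the upper spectral
  bound.\<close>

lemma geometric_decay_bounds:
  assumes \<rho>: "0 < \<rho>" "\<rho> < 1" and \<alpha>: "0 \<le> \<alpha>" and \<zeta>: "0 < \<zeta>" and \<mu>2: "0 \<le> \<mu>2"
    and spectral: "spectral_constants B A b S R \<mu>1 \<mu>2"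
    and decay: "\<And>k. (\<integral>\<omega>. dsq (iter \<omega> (k + 1)) \<partial>P) + \<zeta> * (\<integral>\<omega>. sqn (iter \<omega> (k + 1) - iter \<omega> k) \<partial>P)
      \<le> \<rho> ^ k * (1 + \<alpha>) * dsq x0"
  shows "AE \<omega> in P. converges_vec n (iter \<omega>)"
    and "(\<integral>\<omega>. dsq (iter \<omega> (k + 1)) \<partial>P) \<le> \<rho> ^ k * (1 + \<alpha>) * dsq x0"
    and "(\<integral>\<omega>. expected_loss B A b S R (iter \<omega> (k + 1)) \<partial>P) \<le> \<mu>2 * (1 + \<alpha>) / 2 * \<rho> ^ k * dsq x0"
    and "1 \<le> k \<Longrightarrow> (\<integral>\<omega>. dsq (average_iter n (iter \<omega>) k) \<partial>P) \<le> (1 + \<alpha>) * dsq x0 / (real k * (1 - \<rho>))"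
    and "1 \<le> k \<Longrightarrow> (\<integral>\<omega>. expected_loss B A b S R (average_iter n (iter \<omega>) k) \<partial>P)
      \<le> \<mu>2 * (1 + \<alpha>) / (2 * real k * (1 - \<rho>)) * dsq x0"
proof -
  let ?D = "\<lambda>k. \<integral>\<omega>. dsq (iter \<omega> k) \<partial>P"
  have loss_le: "expected_loss B A b S R x \<le> \<mu>2 / 2 * dsq x" if "x \<in> carrier_vec n" for x
    using spectral that by (simp add: spectral_constants_def)
  have inc: "0 \<le> (\<integral>\<omega>. sqn (iter \<omega> (k + 1) - iter \<omega> k) \<partial>P)" for k
    by (intro Bochner_Integration.integral_nonneg sqn_nonneg minus_carrier_vec iter_carrier)
  show dist: "?D (k + 1) \<le> \<rho> ^ k * (1 + \<alpha>) * dsq x0" for k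
    using decay[of k] mult_nonneg_nonneg[OF less_imp_le[OF \<zeta>] inc[of k]] by linarith
  show "AE \<omega> in P. converges_vec n (iter \<omega>)"
  proof (rule AE_converges_iter[OF \<rho>])
    show "0 \<le> (1 + \<alpha>) * dsq x0 / \<zeta>" using \<alpha> \<zeta> by simp
    show "(\<integral>\<omega>. sqn (iter \<omega> (Suc k) - iter \<omega> k) \<partial>P) \<le> (1 + \<alpha>) * dsq x0 / \<zeta> * \<rho> ^ k" for k
    proof -
      have "0 \<le> ?D (k + 1)" by simp
      then have "\<zeta> * (\<integral>\<omega>. sqn (iter \<omega> (k + 1) - iter \<omega> k) \<partial>P) \<le> \<rho> ^ k * (1 + \<alpha>) * dsq x0"
        using decay[of k] by linarith
      then show ?thesis using \<zeta> by (simp add: field_simps del: momentum_iter.simps(3))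
    qed
  qed
  have "(\<integral>\<omega>. expected_loss B A b S R (iter \<omega> (k + 1)) \<partial>P) \<le> (\<integral>\<omega>. \<mu>2 / 2 * dsq (iter \<omega> (k + 1)) \<partial>P)"
    by (intro integral_mono integrable_iter[of "expected_loss B A b S R"] loss_le iter_carrier
        integrable_mult_right integrable_iter[of dsq])
  also have "\<dots> = \<mu>2 / 2 * ?D (k + 1)" by simp
  also have "\<dots> \<le> \<mu>2 / 2 * (\<rho> ^ k * (1 + \<alpha>) * dsq x0)"
    using dist[of k] \<mu>2 by (intro mult_left_mono) auto
  finally show "(\<integral>\<omega>. expected_loss B A b S R (iter \<omega> (k + 1)) \<partial>P) \<le> \<mu>2 * (1 + \<alpha>) / 2 * \<rho> ^ k * dsq x0"
    by (simp add: mult_ac del: momentum_iter.simps(3))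
  assume k: "1 \<le> k"
  let ?y = "\<lambda>\<omega>. average_iter n (iter \<omega>) k"
  have "real k * (\<integral>\<omega>. dsq (?y \<omega>) \<partial>P) = (\<integral>\<omega>. real k * dsq (?y \<omega>) \<partial>P)" by simp
  also have "\<dots> \<le> (\<integral>\<omega>. (\<Sum>l = 1..k. dsq (iter \<omega> l)) \<partial>P)"
    by (intro integral_mono integrable_mult_right integrable_average_iter[of dsq]
        Bochner_Integration.integrable_sum integrable_iter[of dsq] dsq_average_iter iter_carrier k)
  also have "\<dots> = (\<Sum>l = 1..k. ?D l)"
    by (intro Bochner_Integration.integral_sum integrable_iter[of dsq])
  \<comment> \<open>The bound for iterate \<open>l + 1\<close> has exponent \<open>l\<close>, so
    after this shift the exponents start at 0 and the sum is at most
    \<open>1 / (1 - \<rho>)\<close>.\<close>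
  also have "\<dots> = (\<Sum>l<k. ?D (l + 1))"
    using sum.shift_bounds_Suc_ivl[of ?D 0 k]
    by (simp add: atLeastLessThanSuc_atLeastAtMost lessThan_atLeast0 del: momentum_iter.simps)
  also have "\<dots> \<le> (\<Sum>l<k. \<rho> ^ l * (1 + \<alpha>) * dsq x0)"
    by (intro sum_mono dist)
  also have "\<dots> = (\<Sum>l<k. \<rho> ^ l) * ((1 + \<alpha>) * dsq x0)"
    by (simp add: sum_distrib_right mult.assoc)
  also have "\<dots> \<le> 1 / (1 - \<rho>) * ((1 + \<alpha>) * dsq x0)"
  proof (rule mult_right_mono)
    show "(\<Sum>l<k. \<rho> ^ l) \<le> 1 / (1 - \<rho>)"
      using \<rho> by (simp add: sum_gp_strict divide_right_mono)
  qed (use \<alpha> in simp)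
  finally show avg: "(\<integral>\<omega>. dsq (?y \<omega>) \<partial>P) \<le> (1 + \<alpha>) * dsq x0 / (real k * (1 - \<rho>))"
    using k \<rho> by (simp add: field_simps)
  have "(\<integral>\<omega>. expected_loss B A b S R (?y \<omega>) \<partial>P) \<le> (\<integral>\<omega>. \<mu>2 / 2 * dsq (?y \<omega>) \<partial>P)"
    by (intro integral_mono integrable_average_iter[of "expected_loss B A b S R"] loss_le
        average_iter_carrier integrable_mult_right integrable_average_iter[of dsq])
  also have "\<dots> = \<mu>2 / 2 * (\<integral>\<omega>. dsq (?y \<omega>) \<partial>P)" by simp
  also have "\<dots> \<le> \<mu>2 / 2 * ((1 + \<alpha>) * dsq x0 / (real k * (1 - \<rho>)))"
    using avg \<mu>2 by (intro mult_left_mono) auto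
  finally show "(\<integral>\<omega>. expected_loss B A b S R (?y \<omega>) \<partial>P)
      \<le> \<mu>2 * (1 + \<alpha>) / (2 * real k * (1 - \<rho>)) * dsq x0"
    by (simp add: mult_ac)
qed

lemma momentum_convergence:
  assumes \<delta>: "0 \<le> \<delta>" and \<gamma>: "0 \<le> \<gamma>" and \<zeta>: "0 < \<zeta>"
    and K: "K = 2 / (1 + \<zeta>) - \<delta> + \<gamma>" "0 \<le> K" and \<mu>2: "0 \<le> \<mu>2"
    and spectral: "spectral_constants B A b S R \<mu>1 \<mu>2"
    and upper: "upper_spectral_bound_drawn_anywhere B A b S R \<mu>2"
    and \<rho>: "0 < \<rho>" "\<rho> < 1" and \<alpha>: "0 \<le> \<alpha>"
    and rec: "two_step_rate (1 + \<gamma> - \<delta> * \<mu>1 * (1 + \<zeta>) * K) (\<gamma> * \<delta> * (1 + \<zeta>) * \<mu>2 - \<gamma>)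
      ((\<gamma> + \<gamma>\<^sup>2 * (1 + \<zeta>)) / \<zeta>) \<alpha> \<rho>"
  shows "let X = feasible_set A b;
          f = expected_loss B A b S R;
          x = momentum_iter B A b S \<delta> \<gamma> x0;
          xavg = (\<lambda>\<omega>. average_iter n (x \<omega>))
      in (AE \<omega> in P. converges_vec n (x \<omega>)) \<and>
         (\<forall>k \<ge> 1.
            (\<integral>\<omega>. (dist_wrt B (x \<omega> (k + 1)) X)\<^sup>2 \<partial>P) \<le> \<rho> ^ k * (1 + \<alpha>) * (dist_wrt B x0 X)\<^sup>2 \<and>
            (\<integral>\<omega>. f (x \<omega> (k + 1)) \<partial>P) \<le> \<mu>2 * (1 + \<alpha>) / 2 * \<rho> ^ k * (dist_wrt B x0 X)\<^sup>2 \<and>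
            (\<integral>\<omega>. (dist_wrt B (xavg \<omega> k) X)\<^sup>2 \<partial>P)
              \<le> (1 + \<alpha>) * (dist_wrt B x0 X)\<^sup>2 / (real k * (1 - \<rho>)) \<and>
            (\<integral>\<omega>. f (xavg \<omega> k) \<partial>P)
              \<le> \<mu>2 * (1 + \<alpha>) / (2 * real k * (1 - \<rho>)) * (dist_wrt B x0 X)\<^sup>2)"
proof -
  have decay: "(\<integral>\<omega>. dsq (iter \<omega> (k + 1)) \<partial>P) + \<zeta> * (\<integral>\<omega>. sqn (iter \<omega> (k + 1) - iter \<omega> k) \<partial>P)
      \<le> \<rho> ^ k * (1 + \<alpha>) * dsq x0" for k
  proof -
    let ?F = "\<lambda>k. \<integral>\<omega>. dsq (iter \<omega> k) \<partial>P"
    let ?H = "\<lambda>k. \<zeta> * (\<integral>\<omega>. sqn (iter \<omega> k - iter \<omega> (k - 1)) \<partial>P)"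
    \<comment> \<open>The first two iterates coincide, so the increment term starts at 0.\<close>
    have "x0 - x0 = 0\<^sub>v n" using x0_carrier by simp
    then have H1: "?H 1 = 0" by (simp add: sqnorm_wrt_def)
    have "?F (k + 1) + ?H (k + 1) \<le> \<rho> ^ k * (1 + \<alpha>) * ?F 0"
    proof (rule two_step_rateD[OF rec, of ?F ?H, OF _ _ _ H1])
      show "0 \<le> ?H j" for j
        using \<zeta> by (intro mult_nonneg_nonneg Bochner_Integration.integral_nonneg sqn_nonneg
            minus_carrier_vec iter_carrier) simp_all
      show "?F (j + 2) + ?H (j + 2) \<le> (1 + \<gamma> - \<delta> * \<mu>1 * (1 + \<zeta>) * K) * ?F (j + 1)
        + (\<gamma> * \<delta> * (1 + \<zeta>) * \<mu>2 - \<gamma>) * ?F j + ((\<gamma> + \<gamma>\<^sup>2 * (1 + \<zeta>)) / \<zeta>) * ?H (j + 1)" for j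
        using Lyapunov_recursion[OF \<delta> \<gamma> \<zeta> K spectral upper] .
    qed simp_all
    then show ?thesis by (simp add: prob_space del: momentum_iter.simps(3))
  qed
  note bounds = geometric_decay_bounds[OF \<rho> \<alpha> \<zeta> \<mu>2 spectral decay]
  show ?thesis unfolding Let_def by (intro conjI allI impI bounds)
qed

end

theorem theorem6p7:
  fixes \<delta> \<gamma> \<zeta> \<mu>1 \<mu>2 :: real
  assumes "0 < \<delta>" and "\<delta> < 2" and "0 \<le> \<gamma>" and "\<gamma> < 1" and "0 \<le> \<zeta>"
    and "0 < \<mu>1" and "\<mu>2 \<le> 1"
    and "\<gamma> < \<zeta> / (1 + \<zeta>)"
    and "\<gamma> * \<mu>2 / \<mu>1 < 2 / (1 + \<zeta>) - \<delta> + \<gamma>"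
    and "2 / (1 + \<zeta>) - \<delta> + \<gamma> \<le> (1 + \<gamma>) / (\<delta> * \<mu>1 * (1 + \<zeta>))"
  shows "\<exists>\<alpha> \<rho> :: real. 0 \<le> \<alpha> \<and> 0 < \<rho> \<and> \<rho> < 1 \<and>
    (\<forall>(m :: nat) (n :: nat) (q :: nat) (A :: rmat) (b :: rvec) (B :: rmat) (S :: nat \<Rightarrow> rvec)
        (R :: rule) (x0 :: rvec) (P :: (nat \<Rightarrow> nat) measure).
       A \<in> carrier_mat m n \<and> (\<forall>i < m. row A i \<noteq> 0\<^sub>v n) \<and> b \<in> carrier_vec m \<and>
       feasible_set A b \<noteq> {} \<and>
       sym_pos_def n B \<and>
       (\<forall>i \<in> {1..q}. S i \<in> carrier_vec m \<and> (\<forall>j < m. 0 \<le> vec_index (S i) j) \<and>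
          transpose_mat A *\<^sub>v S i \<noteq> 0\<^sub>v n) \<and>
       sampling_rule n q R \<and>
       spectral_constants B A b S R \<mu>1 \<mu>2 \<and>
       upper_spectral_bound_drawn_anywhere B A b S R \<mu>2 \<and>
       x0 \<in> carrier_vec n \<and>
       index_law B A b S R \<delta> \<gamma> x0 P
       \<longrightarrow>
       (let X = feasible_set A b;
            f = expected_loss B A b S R;
            x = momentum_iter B A b S \<delta> \<gamma> x0;
            xavg = (\<lambda>\<omega>. average_iter n (x \<omega>))
        in (AE \<omega> in P. converges_vec n (x \<omega>)) \<and>
           (\<forall>k \<ge> 1.
              (\<integral>\<omega>. (dist_wrt B (x \<omega> (k + 1)) X)\<^sup>2 \<partial>P) \<le> \<rho> ^ k * (1 + \<alpha>) * (dist_wrt B x0 X)\<^sup>2 \<and>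
              (\<integral>\<omega>. f (x \<omega> (k + 1)) \<partial>P) \<le> \<mu>2 * (1 + \<alpha>) / 2 * \<rho> ^ k * (dist_wrt B x0 X)\<^sup>2 \<and>
              (\<integral>\<omega>. (dist_wrt B (xavg \<omega> k) X)\<^sup>2 \<partial>P)
                \<le> (1 + \<alpha>) * (dist_wrt B x0 X)\<^sup>2 / (real k * (1 - \<rho>)) \<and>
              (\<integral>\<omega>. f (xavg \<omega> k) \<partial>P)
                \<le> \<mu>2 * (1 + \<alpha>) / (2 * real k * (1 - \<rho>)) * (dist_wrt B x0 X)\<^sup>2)))"
proof -
  define K where "K = 2 / (1 + \<zeta>) - \<delta> + \<gamma>"
  have "\<gamma> * (1 + \<zeta>) < \<zeta>" using assms(5,8) by (simp add: field_simps)
  moreover from this have \<zeta>: "0 < \<zeta>" using assms(3,5) by (smt (verit) mult_nonneg_nonneg)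
  \<comment> \<open>Since \<open>\<gamma> * (1 + \<zeta>) < \<zeta>\<close>, the inner factor is at
    most \<open>1 + \<zeta>\<close>, and the same inequality applies once more.\<close>
  ultimately have "\<gamma> * (1 + \<gamma> * (1 + \<zeta>)) < \<zeta>"
    using mult_left_mono[of "1 + \<gamma> * (1 + \<zeta>)" "1 + \<zeta>" \<gamma>] assms(3) by linarith
  then have c: "(\<gamma> + \<gamma>\<^sup>2 * (1 + \<zeta>)) / \<zeta> < 1"
    using \<zeta> by (simp add: algebra_simps power2_eq_square)
  \<comment> \<open>The terms in \<open>\<gamma>\<close> alone cancel; what remains is the strict
    lower bound on \<open>K\<close>, multiplied by
    \<open>\<delta> * \<mu>1 * (1 + \<zeta>)\<close>.\<close>
  have ab: "(1 + \<gamma> - \<delta> * \<mu>1 * (1 + \<zeta>) * K) + (\<gamma> * \<delta> * (1 + \<zeta>) * \<mu>2 - \<gamma>) < 1"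
  proof -
    have "\<gamma> * \<mu>2 < \<mu>1 * K" using assms(6,9) by (simp add: K_def field_simps)
    then have "(\<delta> * (1 + \<zeta>)) * (\<gamma> * \<mu>2) < (\<delta> * (1 + \<zeta>)) * (\<mu>1 * K)"
      using assms(1,5) by (intro mult_strict_left_mono) auto
    then show ?thesis by (simp add: algebra_simps)
  qed
  show ?thesis
  \<comment> \<open>The constants are chosen before any system is given, so this case distinction
    concerns the numbers alone. In the first case \<open>\<mu>2\<close> is positive, which makes
    \<open>K\<close> nonnegative.\<close>
  proof (cases "\<mu>1 \<le> \<mu>2")
    case True
    then have \<mu>2: "0 < \<mu>2" using assms(6) by simp
    have K: "0 \<le> K"
      using assms(3,6,9) \<mu>2 unfolding K_def by (smt (verit) divide_nonneg_pos mult_nonneg_nonneg)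
    have a: "1 + \<gamma> - \<delta> * \<mu>1 * (1 + \<zeta>) * K < 2"
      using assms K by (smt (verit) mult_nonneg_nonneg)
    obtain \<alpha> \<rho> where \<alpha>: "0 \<le> \<alpha>" and \<rho>: "0 < \<rho>" "\<rho> < 1" and
      rec: "two_step_rate (1 + \<gamma> - \<delta> * \<mu>1 * (1 + \<zeta>) * K) (\<gamma> * \<delta> * (1 + \<zeta>) * \<mu>2 - \<gamma>)
        ((\<gamma> + \<gamma>\<^sup>2 * (1 + \<zeta>)) / \<zeta>) \<alpha> \<rho>"
      using two_step_recursion[OF a ab c] by blast
    show ?thesis
    proof (rule exI[of _ \<alpha>], rule exI[of _ \<rho>], intro conjI \<alpha> \<rho> allI impI, goal_cases)
      case (1 m n q A b B S R x0 P)
      then have "momentum_method n B m q A b S R P \<delta> \<gamma> x0"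
        unfolding momentum_method_def sketched_system_def pos_def_form_def
          sketched_system_axioms_def momentum_method_axioms_def index_law_def by auto
      from momentum_method.momentum_convergence[OF this less_imp_le[OF assms(1)]
          assms(3) \<zeta> K_def K less_imp_le[OF \<mu>2] _ _ \<rho> \<alpha> rec] 1
      show ?case by blast
    qed
  next
    case False
    show ?thesis
    \<comment> \<open>No system satisfies the hypotheses here, by
      \<open>spectral_constants_ordered\<close>; 0 and 1/2 are arbitrary admissible values.\<close>
    proof (rule exI[of _ 0], rule exI[of _ "1 / 2"], intro conjI allI impI, goal_cases)
      case (4 m n q A b B S R x0 P)
      then have "sketched_system n B m q A b S R"
        unfolding sketched_system_def pos_def_form_def sketched_system_axioms_def by auto
      with 4 have "\<mu>1 \<le> \<mu>2"
        using sketched_system.spectral_constants_ordered by blast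
      with False show ?case by simp
    qed simp_all
  qed
qed

end
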